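(* Let $\mathbb F$ be a field of characteristic zero, let $A$ be a finite-dimensional $\mathbb F$-vector space with dual $A^*$, and let $(A,\cdot,[\cdot,\cdot,\cdot])$ and $(A^*,\circ,[\cdot,\cdot,\cdot]^* )$ be two Poisson 3-Lie algebras. Then $\big((A\oplus A^*,\mathcal B),A,A^*\big)$ is a standard Manin triple of Poisson 3-Lie algebras if and only if $(A,A^*,\mathrm{ad}^*,-\mathcal L^*,\mathfrak{ad}^*,-L^* )$ is a matched pair of Poisson 3-Lie algebras.
   Context: All vector spaces are finite-dimensional over a field $\mathbb F$ of characteristic zero; no unit is assumed in algebras; $\langle\cdot,\cdot\rangle$ is the pairing between a space and its dual, and $(A^* )^*=A$. 3-Lie algebra: vector space with a skew-symmetric trilinear bracket satisfying $[x_1,x_2,[x_3,x_4,x_5]]=[[x_1,x_2,x_3],x_4,x_5]+[x_3,[x_1,x_2,x_4],x_5]+[x_3,x_4,[x_1,x_2,x_5]]$. Poisson 3-Lie algebra $(A,\cdot,[\cdot,\cdot,\cdot])$: $(A,\cdot)$ commutative associative, $(A,[\cdot,\cdot,\cdot])$ a 3-Lie algebra, and $[w\cdot x,y,z]=w\cdot[x,y,z]+x\cdot[w,y,z]$. Representations. A representation of a commutative associative algebra $(A,\cdot)$ on $V$: linear $\mu:A\to\mathfrak{gl}(V)$ with $\mu(x\cdot y)=\mu(x)\mu(y)$. A representation of a 3-Lie algebra on $V$: a skew-symmetric linear $\rho:\otimes^2A\to\mathfrak{gl}(V)$ with $\rho(x_1,x_2)\rho(x_3,x_4)-\rho(x_3,x_4)\rho(x_1,x_2)=\rho([x_1,x_2,x_3],x_4)-\rho([x_1,x_2,x_4],x_3)$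 and $\rho([x_1,x_2,x_3],x_4)=\rho(x_1,x_2)\rho(x_3,x_4)+\rho(x_2,x_3)\rho(x_1,x_4)+\rho(x_3,x_1)\rho(x_2,x_4)$. A representation $(V,\rho,\mu)$ of a Poisson 3-Lie algebra: both of these together with $\rho(x\cdot y,z)=\mu(x)\rho(y,z)+\mu(y)\rho(x,z)$ and $\rho(x,y)\mu(z)=\mu([x,y,z])+\mu(z)\rho(x,y)$. Duals: $\langle\rho^*(x_1,x_2)\xi,v\rangle=-\langle\xi,\rho(x_1,x_2)v\rangle$, $\langle\mu^*(x)\xi,v\rangle=-\langle\xi,\mu(x)v\rangle$. On $A$: $\mathrm{ad}_{x,y}z=[x,y,z]$, $\mathcal L(x)y=x\cdot y$. On $A^*$: $\mathfrak{ad}_{\xi,\eta}\zeta=[\xi,\eta,\zeta]^*$, $L(\xi)\eta=\xi\circ\eta$. So $\mathrm{ad}^*:\otimes^2A\to\mathfrak{gl}(A^* )$, $\mathcal L^*:A\to\mathfrak{gl}(A^* )$, $\mathfrak{ad}^*:\otimes^2A^*\to\mathfrak{gl}(A)$, $L^*:A^*\to\mathfrak{gl}(A)$. Matched pair of commutative associative algebras $(A,B,\mu_A,\mu_B)$: $(B,\mu_A)$, $(A,\mu_B)$ are representations of $(A,\cdot_A)$, $(B,\cdot_B)$ and, for $x,y\in A$, $a,b\in B$, $\mu_A(x)(a\cdot_Bb)=(\mu_A(x)a)\cdot_Bb+\mu_A(\mu_B(a)x)b$ and $\mu_B(a)(x\cdot_Ay)=(\mu_B(a)x)\cdot_Ay+\mu_B(\mu_A(x)a)y$.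 Matched pair of 3-Lie algebras $(A,B,\rho_A,\rho_B)$: $(B,\rho_A)$, $(A,\rho_B)$ are representations of the 3-Lie algebras $A$, $B$ and for $x_i\in A$, $y_i\in B$: $\rho_B(y_4,y_5)[x_1,x_2,x_3]_A=[\rho_B(y_4,y_5)x_1,x_2,x_3]_A+[x_1,\rho_B(y_4,y_5)x_2,x_3]_A+[x_1,x_2,\rho_B(y_4,y_5)x_3]_A$; $-\rho_B(\rho_A(x_1,x_2)y_3,y_5)x_4=-\rho_B(\rho_A(x_1,x_4)y_5,y_3)x_2+\rho_B(\rho_A(x_2,x_4)y_5,y_3)x_1-[x_1,x_2,\rho_B(y_3,y_5)x_4]_A$; $[\rho_B(y_2,y_3)x_1,x_4,x_5]_A=\rho_B(y_2,y_3)[x_1,x_4,x_5]_A+\rho_B(\rho_A(x_4,x_5)y_2,y_3)x_1+\rho_B(y_2,\rho_A(x_4,x_5)y_3)x_1$; and the three identities obtained by exchanging the roles of $A$ and $B$ (i.e. $x\leftrightarrow y$, $A\leftrightarrow B$). Matched pair of Poisson 3-Lie algebras $(A,B,\rho_A,\mu_A,\rho_B,\mu_B)$ ($A,B$ Poisson 3-Lie algebras): $(A,B,\mu_A,\mu_B)$ is a matched pair of commutative associative algebras, $(A,B,\rho_A,\rho_B)$ is a matched pair of 3-Lie algebras, $(B,\rho_A,\mu_A)$ and $(A,\rho_B,\mu_B)$ are representations of the Poisson 3-Lie algebras $A$ and $B$, and for $x_i\in A,y_i\in B$: $[\mu_B(y_1)x_1,x_2,x_3]_A=\mu_B(\rho_A(x_2,x_3)y_1)x_1+\mu_B(y_1)[x_1,x_2,x_3]_A$;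 $[\mu_A(x_1)y_1,y_2,y_3]_B=\mu_A(\rho_B(y_2,y_3)x_1)y_1+\mu_A(x_1)[y_1,y_2,y_3]_B$; $\rho_B(\mu_A(x_1)y_1,y_2)x_2=x_1\cdot_A(\rho_B(y_1,y_2)x_2)$; $\rho_A(\mu_B(y_1)x_1,x_2)y_2=y_1\cdot_B(\rho_A(x_1,x_2)y_2)$; $\mu_B(\rho_A(x_1,x_2)y_1)x_3+\mu_B(\rho_A(x_3,x_2)y_1)x_1=0$; $\mu_A(\rho_B(y_1,y_2)x_1)y_3+\mu_A(\rho_B(y_3,y_2)x_1)y_1=0$; $\rho_B(y_3,y_4)(x_1\cdot_Ax_2)=x_1\cdot_A(\rho_B(y_3,y_4)x_2)+x_2\cdot_A(\rho_B(y_3,y_4)x_1)$; $\rho_A(x_3,x_4)(y_1\cdot_By_2)=y_1\cdot_B(\rho_A(x_3,x_4)y_2)+y_2\cdot_B(\rho_A(x_3,x_4)y_1)$. Manin triples. A bilinear form $\mathcal B$ on a Poisson 3-Lie algebra is invariant if $\mathcal B(x\cdot y,z)=\mathcal B(x,y\cdot z)$ and $\mathcal B([x,y,z],u)=-\mathcal B([x,y,u],z)$. A Manin triple $((P,\mathcal B),A_1,A_2)$ of Poisson 3-Lie algebras: $P$ is a Poisson 3-Lie algebra with nondegenerate symmetric invariant bilinear form $\mathcal B$; $A_1,A_2$ are Poisson 3-Lie subalgebras isotropic for $\mathcal B$ ($\mathcal B|_{A_i\times A_i}=0$); $P=A_1\oplus A_2$ as vector spaces; and $\mathrm{pr}_1[x_1,y_1,x_2]=0$,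 $\mathrm{pr}_2[x_2,y_2,x_1]=0$ for $x_1,y_1\in A_1$, $x_2,y_2\in A_2$ ($\mathrm{pr}_i$ the projections to $A_i$). $\big((A\oplus A^*,\mathcal B),A,A^*\big)$ is a standard Manin triple if it is a Manin triple of Poisson 3-Lie algebras, where $\mathcal B(x+\xi,y+\eta)=\langle x,\eta\rangle+\langle y,\xi\rangle$ and $A\oplus A^*$ carries the operations $[x+\xi,y+\eta,z+\zeta]_{A\oplus A^*}=[x,y,z]+\mathrm{ad}^*_{x,y}\zeta-\mathrm{ad}^*_{x,z}\eta+\mathrm{ad}^*_{y,z}\xi+[\xi,\eta,\zeta]^*+\mathfrak{ad}^*_{\xi,\eta}z-\mathfrak{ad}^*_{\xi,\zeta}y+\mathfrak{ad}^*_{\eta,\zeta}x$, $(x+\xi)\cdot_{A\oplus A^*}(y+\eta)=x\cdot y-\mathcal L^*(x)\eta-\mathcal L^*(y)\xi+\xi\circ\eta-L^*(\xi)y-L^*(\eta)x$ (in particular these operations make $A\oplus A^*$ a Poisson 3-Lie algebra). *)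

theory Defs
  imports "HOL-Analysis.Product_Vector" "HOL-Library.Function_Algebras"
begin

text \<open>
  A space is a linear subspace \<open>V\<close> (the carrier) of an ambient vector space type with scalar
  multiplication \<open>s\<close>. Carriers are needed because the dual of a space is a proper subset of a
  function type. Operations are total HOL functions whose values matter on the carriers only.
\<close>

locale linear_space = vector_space s
  for s :: "'f::field_char_0 \<Rightarrow> 'v::ab_group_add \<Rightarrow> 'v" +
  fixes V :: "'v set"
  assumes subspace_carrier: "subspace V"

definition linear_on ::
  "('f \<Rightarrow> 'v \<Rightarrow> 'v::ab_group_add) \<Rightarrow> 'v set \<Rightarrow> ('f \<Rightarrow> 'w \<Rightarrow> 'w::ab_group_add) \<Rightarrow> 'w set
    \<Rightarrow> ('v \<Rightarrow> 'w) \<Rightarrow> bool" where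
  "linear_on s V t W f \<longleftrightarrow>
     (\<forall>x\<in>V. f x \<in> W) \<and>
     (\<forall>x\<in>V. \<forall>y\<in>V. f (x + y) = f x + f y) \<and>
     (\<forall>c. \<forall>x\<in>V. f (s c x) = t c (f x))"

definition bilinear_on ::
  "('f \<Rightarrow> 'u \<Rightarrow> 'u::ab_group_add) \<Rightarrow> 'u set \<Rightarrow> ('f \<Rightarrow> 'v \<Rightarrow> 'v::ab_group_add) \<Rightarrow> 'v set
    \<Rightarrow> ('f \<Rightarrow> 'w \<Rightarrow> 'w::ab_group_add) \<Rightarrow> 'w set \<Rightarrow> ('u \<Rightarrow> 'v \<Rightarrow> 'w) \<Rightarrow> bool" where
  "bilinear_on r U s V t W f \<longleftrightarrow>
     (\<forall>x\<in>U. linear_on s V t W (\<lambda>y. f x y)) \<and>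
     (\<forall>y\<in>V. linear_on r U t W (\<lambda>x. f x y))"

definition trilinear_on ::
  "('f \<Rightarrow> 'u \<Rightarrow> 'u::ab_group_add) \<Rightarrow> 'u set \<Rightarrow> ('f \<Rightarrow> 'v \<Rightarrow> 'v::ab_group_add) \<Rightarrow> 'v set
    \<Rightarrow> ('f \<Rightarrow> 'w \<Rightarrow> 'w::ab_group_add) \<Rightarrow> 'w set \<Rightarrow> ('f \<Rightarrow> 'z \<Rightarrow> 'z::ab_group_add) \<Rightarrow> 'z set
    \<Rightarrow> ('u \<Rightarrow> 'v \<Rightarrow> 'w \<Rightarrow> 'z) \<Rightarrow> bool" where
  "trilinear_on r U s V t W q Z f \<longleftrightarrow>
     (\<forall>x\<in>U. \<forall>y\<in>V. linear_on t W q Z (\<lambda>z. f x y z)) \<and>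
     (\<forall>x\<in>U. \<forall>z\<in>W. linear_on s V q Z (\<lambda>y. f x y z)) \<and>
     (\<forall>y\<in>V. \<forall>z\<in>W. linear_on r U q Z (\<lambda>x. f x y z))"


section \<open>Poisson 3-Lie algebras\<close>

locale comm_assoc_algebra = linear_space s V
  for s :: "'f::field_char_0 \<Rightarrow> 'v::ab_group_add \<Rightarrow> 'v" and V +
  fixes mul :: "'v \<Rightarrow> 'v \<Rightarrow> 'v"
  assumes mul_bilinear: "bilinear_on s V s V s V mul"
    and mul_commute: "\<lbrakk>x \<in> V; y \<in> V\<rbrakk> \<Longrightarrow> mul x y = mul y x"
    and mul_assoc: "\<lbrakk>x \<in> V; y \<in> V; z \<in> V\<rbrakk> \<Longrightarrow> mul (mul x y) z = mul x (mul y z)"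

locale three_lie_algebra = linear_space s V
  for s :: "'f::field_char_0 \<Rightarrow> 'v::ab_group_add \<Rightarrow> 'v" and V +
  fixes br :: "'v \<Rightarrow> 'v \<Rightarrow> 'v \<Rightarrow> 'v"
  assumes br_trilinear: "trilinear_on s V s V s V s V br"
    and br_skew12: "\<lbrakk>x \<in> V; y \<in> V; z \<in> V\<rbrakk> \<Longrightarrow> br y x z = - br x y z"
    and br_skew23: "\<lbrakk>x \<in> V; y \<in> V; z \<in> V\<rbrakk> \<Longrightarrow> br x z y = - br x y z"
    and fundamental_identity:
      "\<lbrakk>x1 \<in> V; x2 \<in> V; x3 \<in> V; x4 \<in> V; x5 \<in> V\<rbrakk> \<Longrightarrow>
         br x1 x2 (br x3 x4 x5) =
           br (br x1 x2 x3) x4 x5 + br x3 (br x1 x2 x4) x5 + br x3 x4 (br x1 x2 x5)"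

locale poisson_three_lie_algebra =
  comm_assoc_algebra s V mul + three_lie_algebra s V br
  for s :: "'f::field_char_0 \<Rightarrow> 'v::ab_group_add \<Rightarrow> 'v" and V mul br +
  assumes leibniz:
    "\<lbrakk>w \<in> V; x \<in> V; y \<in> V; z \<in> V\<rbrakk> \<Longrightarrow>
       br (mul w x) y z = mul w (br x y z) + mul x (br w y z)"


section \<open>Representations\<close>

text \<open>
  Linear maps into \<open>gl(W)\<close> are kept in curried form: a linear map \<open>V \<rightarrow> gl(W)\<close> is a bilinear map
  \<open>V \<times> W \<rightarrow> W\<close>, and a linear map \<open>V \<otimes> V \<rightarrow> gl(W)\<close> is a trilinear map \<open>V \<times> V \<times> W \<rightarrow> W\<close>.
\<close>

locale comm_assoc_rep = comm_assoc_algebra s V mul + W: linear_space t W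
  for s :: "'f::field_char_0 \<Rightarrow> 'v::ab_group_add \<Rightarrow> 'v" and V mul
    and t :: "'f \<Rightarrow> 'w::ab_group_add \<Rightarrow> 'w" and W +
  fixes mu :: "'v \<Rightarrow> 'w \<Rightarrow> 'w"
  assumes mu_linear: "bilinear_on s V t W t W mu"
    and mu_mul: "\<lbrakk>x \<in> V; y \<in> V; w \<in> W\<rbrakk> \<Longrightarrow> mu (mul x y) w = mu x (mu y w)"

locale three_lie_rep = three_lie_algebra s V br + W: linear_space t W
  for s :: "'f::field_char_0 \<Rightarrow> 'v::ab_group_add \<Rightarrow> 'v" and V br
    and t :: "'f \<Rightarrow> 'w::ab_group_add \<Rightarrow> 'w" and W +
  fixes rho :: "'v \<Rightarrow> 'v \<Rightarrow> 'w \<Rightarrow> 'w"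
  assumes rho_linear: "trilinear_on s V s V t W t W rho"
    and rho_skew: "\<lbrakk>x \<in> V; y \<in> V; w \<in> W\<rbrakk> \<Longrightarrow> rho y x w = - rho x y w"
    and rho_commutator:
      "\<lbrakk>x1 \<in> V; x2 \<in> V; x3 \<in> V; x4 \<in> V; w \<in> W\<rbrakk> \<Longrightarrow>
         rho x1 x2 (rho x3 x4 w) - rho x3 x4 (rho x1 x2 w) =
           rho (br x1 x2 x3) x4 w - rho (br x1 x2 x4) x3 w"
    and rho_br:
      "\<lbrakk>x1 \<in> V; x2 \<in> V; x3 \<in> V; x4 \<in> V; w \<in> W\<rbrakk> \<Longrightarrow>
         rho (br x1 x2 x3) x4 w =
           rho x1 x2 (rho x3 x4 w) + rho x2 x3 (rho x1 x4 w) + rho x3 x1 (rho x2 x4 w)"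

locale poisson_three_lie_rep =
  poisson_three_lie_algebra s V mul br +
  comm_assoc_rep s V mul t W mu + three_lie_rep s V br t W rho
  for s :: "'f::field_char_0 \<Rightarrow> 'v::ab_group_add \<Rightarrow> 'v" and V mul br
    and t :: "'f \<Rightarrow> 'w::ab_group_add \<Rightarrow> 'w" and W rho mu +
  assumes rho_mul:
      "\<lbrakk>x \<in> V; y \<in> V; z \<in> V; w \<in> W\<rbrakk> \<Longrightarrow>
         rho (mul x y) z w = mu x (rho y z w) + mu y (rho x z w)"
    and rho_mu:
      "\<lbrakk>x \<in> V; y \<in> V; z \<in> V; w \<in> W\<rbrakk> \<Longrightarrow>
         rho x y (mu z w) = mu (br x y z) w + mu z (rho x y w)"


section \<open>Matched pairs\<close>

locale matched_pair_comm_assoc =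
  A_rep: comm_assoc_rep sA A mulA sB B muA + B_rep: comm_assoc_rep sB B mulB sA A muB
  for sA :: "'f::field_char_0 \<Rightarrow> 'a::ab_group_add \<Rightarrow> 'a" and A mulA
    and sB :: "'f \<Rightarrow> 'b::ab_group_add \<Rightarrow> 'b" and B mulB and muA muB +
  assumes muA_mulB:
      "\<lbrakk>x \<in> A; a \<in> B; b \<in> B\<rbrakk> \<Longrightarrow> muA x (mulB a b) = mulB (muA x a) b + muA (muB a x) b"
    and muB_mulA:
      "\<lbrakk>a \<in> B; x \<in> A; y \<in> A\<rbrakk> \<Longrightarrow> muB a (mulA x y) = mulA (muB a x) y + muB (muA x a) y"

text \<open>
  The three compatibility identities with values in \<open>A\<close>; the remaining three of a matched pair are
  obtained by exchanging the roles of \<open>A\<close> and \<open>B\<close>.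
\<close>

definition three_lie_compatible ::
  "'a::ab_group_add set \<Rightarrow> ('a \<Rightarrow> 'a \<Rightarrow> 'a \<Rightarrow> 'a) \<Rightarrow> 'b::ab_group_add set
    \<Rightarrow> ('a \<Rightarrow> 'a \<Rightarrow> 'b \<Rightarrow> 'b) \<Rightarrow> ('b \<Rightarrow> 'b \<Rightarrow> 'a \<Rightarrow> 'a) \<Rightarrow> bool" where
  "three_lie_compatible A brA B rhoA rhoB \<longleftrightarrow>
     (\<forall>x1\<in>A. \<forall>x2\<in>A. \<forall>x3\<in>A. \<forall>y4\<in>B. \<forall>y5\<in>B.
        rhoB y4 y5 (brA x1 x2 x3) =
          brA (rhoB y4 y5 x1) x2 x3 + brA x1 (rhoB y4 y5 x2) x3 + brA x1 x2 (rhoB y4 y5 x3)) \<and>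
     (\<forall>x1\<in>A. \<forall>x2\<in>A. \<forall>x4\<in>A. \<forall>y3\<in>B. \<forall>y5\<in>B.
        - rhoB (rhoA x1 x2 y3) y5 x4 =
          - rhoB (rhoA x1 x4 y5) y3 x2 + rhoB (rhoA x2 x4 y5) y3 x1 - brA x1 x2 (rhoB y3 y5 x4)) \<and>
     (\<forall>x1\<in>A. \<forall>x4\<in>A. \<forall>x5\<in>A. \<forall>y2\<in>B. \<forall>y3\<in>B.
        brA (rhoB y2 y3 x1) x4 x5 =
          rhoB y2 y3 (brA x1 x4 x5) + rhoB (rhoA x4 x5 y2) y3 x1 + rhoB y2 (rhoA x4 x5 y3) x1)"

locale matched_pair_three_lie =
  A_rep: three_lie_rep sA A brA sB B rhoA + B_rep: three_lie_rep sB B brB sA A rhoB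
  for sA :: "'f::field_char_0 \<Rightarrow> 'a::ab_group_add \<Rightarrow> 'a" and A brA
    and sB :: "'f \<Rightarrow> 'b::ab_group_add \<Rightarrow> 'b" and B brB and rhoA rhoB +
  assumes compatible_A: "three_lie_compatible A brA B rhoA rhoB"
    and compatible_B: "three_lie_compatible B brB A rhoB rhoA"

locale matched_pair_poisson_three_lie =
  CA: matched_pair_comm_assoc sA A mulA sB B mulB muA muB +
  TL: matched_pair_three_lie sA A brA sB B brB rhoA rhoB +
  A_rep: poisson_three_lie_rep sA A mulA brA sB B rhoA muA +
  B_rep: poisson_three_lie_rep sB B mulB brB sA A rhoB muB
  for sA :: "'f::field_char_0 \<Rightarrow> 'a::ab_group_add \<Rightarrow> 'a" and A mulA brA
    and sB :: "'f \<Rightarrow> 'b::ab_group_add \<Rightarrow> 'b" and B mulB brB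
    and rhoA muA rhoB muB +
  assumes br_muB:
      "\<lbrakk>x1 \<in> A; x2 \<in> A; x3 \<in> A; y1 \<in> B\<rbrakk> \<Longrightarrow>
         brA (muB y1 x1) x2 x3 = muB (rhoA x2 x3 y1) x1 + muB y1 (brA x1 x2 x3)"
    and br_muA:
      "\<lbrakk>y1 \<in> B; y2 \<in> B; y3 \<in> B; x1 \<in> A\<rbrakk> \<Longrightarrow>
         brB (muA x1 y1) y2 y3 = muA (rhoB y2 y3 x1) y1 + muA x1 (brB y1 y2 y3)"
    and rhoB_muA:
      "\<lbrakk>x1 \<in> A; x2 \<in> A; y1 \<in> B; y2 \<in> B\<rbrakk> \<Longrightarrow>
         rhoB (muA x1 y1) y2 x2 = mulA x1 (rhoB y1 y2 x2)"
    and rhoA_muB: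
      "\<lbrakk>x1 \<in> A; x2 \<in> A; y1 \<in> B; y2 \<in> B\<rbrakk> \<Longrightarrow>
         rhoA (muB y1 x1) x2 y2 = mulB y1 (rhoA x1 x2 y2)"
    and muB_rhoA:
      "\<lbrakk>x1 \<in> A; x2 \<in> A; x3 \<in> A; y1 \<in> B\<rbrakk> \<Longrightarrow>
         muB (rhoA x1 x2 y1) x3 + muB (rhoA x3 x2 y1) x1 = 0"
    and muA_rhoB:
      "\<lbrakk>y1 \<in> B; y2 \<in> B; y3 \<in> B; x1 \<in> A\<rbrakk> \<Longrightarrow>
         muA (rhoB y1 y2 x1) y3 + muA (rhoB y3 y2 x1) y1 = 0"
    and rhoB_mulA:
      "\<lbrakk>x1 \<in> A; x2 \<in> A; y3 \<in> B; y4 \<in> B\<rbrakk> \<Longrightarrow>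
         rhoB y3 y4 (mulA x1 x2) = mulA x1 (rhoB y3 y4 x2) + mulA x2 (rhoB y3 y4 x1)"
    and rhoA_mulB:
      "\<lbrakk>y1 \<in> B; y2 \<in> B; x3 \<in> A; x4 \<in> A\<rbrakk> \<Longrightarrow>
         rhoA x3 x4 (mulB y1 y2) = mulB y1 (rhoA x3 x4 y2) + mulB y2 (rhoA x3 x4 y1)"


section \<open>Manin triples\<close>

definition poisson_three_lie_subalgebra ::
  "('f::field_char_0 \<Rightarrow> 'v::ab_group_add \<Rightarrow> 'v) \<Rightarrow> 'v set \<Rightarrow> ('v \<Rightarrow> 'v \<Rightarrow> 'v)
    \<Rightarrow> ('v \<Rightarrow> 'v \<Rightarrow> 'v \<Rightarrow> 'v) \<Rightarrow> 'v set \<Rightarrow> bool" where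
  "poisson_three_lie_subalgebra s V mul br U \<longleftrightarrow>
     U \<subseteq> V \<and> module.subspace s U \<and>
     (\<forall>x\<in>U. \<forall>y\<in>U. mul x y \<in> U) \<and>
     (\<forall>x\<in>U. \<forall>y\<in>U. \<forall>z\<in>U. br x y z \<in> U)"

text \<open>The projection onto \<open>U1\<close> along \<open>U2\<close>, meaningful on the internal direct sum of \<open>U1\<close> and \<open>U2\<close>.\<close>

definition proj_along :: "'v::ab_group_add set \<Rightarrow> 'v set \<Rightarrow> 'v \<Rightarrow> 'v" where
  "proj_along U1 U2 v = (THE u. u \<in> U1 \<and> v - u \<in> U2)"

locale manin_triple = poisson_three_lie_algebra s P mul br
  for s :: "'f::field_char_0 \<Rightarrow> 'p::ab_group_add \<Rightarrow> 'p" and P mul br +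
  fixes form :: "'p \<Rightarrow> 'p \<Rightarrow> 'f" and A1 A2 :: "'p set"
  assumes form_bilinear: "bilinear_on s P s P (*) UNIV form"
    and form_symmetric: "\<lbrakk>x \<in> P; y \<in> P\<rbrakk> \<Longrightarrow> form x y = form y x"
    and form_nondegenerate: "\<lbrakk>x \<in> P; \<And>y. y \<in> P \<Longrightarrow> form x y = 0\<rbrakk> \<Longrightarrow> x = 0"
    and form_invariant_mul:
      "\<lbrakk>x \<in> P; y \<in> P; z \<in> P\<rbrakk> \<Longrightarrow> form (mul x y) z = form x (mul y z)"
    and form_invariant_br:
      "\<lbrakk>x \<in> P; y \<in> P; z \<in> P; u \<in> P\<rbrakk> \<Longrightarrow> form (br x y z) u = - form (br x y u) z"
    and subalgebra1: "poisson_three_lie_subalgebra s P mul br A1"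
    and subalgebra2: "poisson_three_lie_subalgebra s P mul br A2"
    and isotropic1: "\<lbrakk>x \<in> A1; y \<in> A1\<rbrakk> \<Longrightarrow> form x y = 0"
    and isotropic2: "\<lbrakk>x \<in> A2; y \<in> A2\<rbrakk> \<Longrightarrow> form x y = 0"
    and direct_sum: "P = {x + y |x y. x \<in> A1 \<and> y \<in> A2}" "A1 \<inter> A2 = {0}"
    and proj1_br: "\<lbrakk>x1 \<in> A1; y1 \<in> A1; x2 \<in> A2\<rbrakk> \<Longrightarrow> proj_along A1 A2 (br x1 y1 x2) = 0"
    and proj2_br: "\<lbrakk>x2 \<in> A2; y2 \<in> A2; x1 \<in> A1\<rbrakk> \<Longrightarrow> proj_along A2 A1 (br x2 y2 x1) = 0"


section \<open>The dual space and dual operators\<close>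

definition dual_space :: "('f::field \<Rightarrow> 'a::ab_group_add \<Rightarrow> 'a) \<Rightarrow> ('a \<Rightarrow> 'f) set" where
  "dual_space s = {\<xi>. Vector_Spaces.linear s (*) \<xi>}"

definition dual_scale :: "'f::field \<Rightarrow> ('a \<Rightarrow> 'f) \<Rightarrow> 'a \<Rightarrow> 'f" where
  "dual_scale c \<xi> = (\<lambda>v. c * \<xi> v)"

text \<open>For an operator \<open>f\<close> on the space, the operator \<open>f\<^sup>*\<close> on the dual with
  \<open>\<langle>f\<^sup>* \<xi>, v\<rangle> = - \<langle>\<xi>, f v\<rangle>\<close>.\<close>

definition dual_op :: "('a \<Rightarrow> 'a) \<Rightarrow> ('a \<Rightarrow> 'f::field) \<Rightarrow> 'a \<Rightarrow> 'f" where
  "dual_op f \<xi> = (\<lambda>v. - \<xi> (f v))"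

text \<open>For an operator \<open>g\<close> on the dual, the operator \<open>g\<^sup>*\<close> on the bidual, transported to the space
  itself along the evaluation isomorphism: \<open>g\<^sup>* x\<close> is the vector with
  \<open>\<langle>\<zeta>, g\<^sup>* x\<rangle> = - \<langle>g \<zeta>, x\<rangle>\<close> for all \<open>\<zeta>\<close>, which exists and is unique in finite dimension.\<close>

definition codual_op ::
  "('f::field \<Rightarrow> 'a::ab_group_add \<Rightarrow> 'a) \<Rightarrow> (('a \<Rightarrow> 'f) \<Rightarrow> ('a \<Rightarrow> 'f)) \<Rightarrow> 'a \<Rightarrow> 'a" where
  "codual_op s g x = (THE v. \<forall>\<zeta>\<in>dual_space s. \<zeta> v = - g \<zeta> x)"

definition ad_star ::
  "('a \<Rightarrow> 'a \<Rightarrow> 'a \<Rightarrow> 'a) \<Rightarrow> 'a \<Rightarrow> 'a \<Rightarrow> ('a \<Rightarrow> 'f::field) \<Rightarrow> ('a \<Rightarrow> 'f)" where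
  "ad_star br x y = dual_op (\<lambda>z. br x y z)"

definition L_star :: "('a \<Rightarrow> 'a \<Rightarrow> 'a) \<Rightarrow> 'a \<Rightarrow> ('a \<Rightarrow> 'f::field) \<Rightarrow> ('a \<Rightarrow> 'f)" where
  "L_star mul x = dual_op (\<lambda>y. mul x y)"

definition coad_star ::
  "('f::field \<Rightarrow> 'a::ab_group_add \<Rightarrow> 'a) \<Rightarrow>
    (('a \<Rightarrow> 'f) \<Rightarrow> ('a \<Rightarrow> 'f) \<Rightarrow> ('a \<Rightarrow> 'f) \<Rightarrow> ('a \<Rightarrow> 'f)) \<Rightarrow> ('a \<Rightarrow> 'f) \<Rightarrow> ('a \<Rightarrow> 'f) \<Rightarrow> 'a \<Rightarrow> 'a" where
  "coad_star s brd \<xi> \<eta> = codual_op s (\<lambda>\<zeta>. brd \<xi> \<eta> \<zeta>)"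

definition coL_star ::
  "('f::field \<Rightarrow> 'a::ab_group_add \<Rightarrow> 'a) \<Rightarrow>
    (('a \<Rightarrow> 'f) \<Rightarrow> ('a \<Rightarrow> 'f) \<Rightarrow> ('a \<Rightarrow> 'f)) \<Rightarrow> ('a \<Rightarrow> 'f) \<Rightarrow> 'a \<Rightarrow> 'a" where
  "coL_star s muld \<xi> = codual_op s (\<lambda>\<eta>. muld \<xi> \<eta>)"


section \<open>The standard Manin triple\<close>

text \<open>An element \<open>x + \<xi>\<close> of the direct sum of the space and its dual is the pair \<open>(x, \<xi>)\<close>.\<close>

fun double_form :: "'a \<times> ('a \<Rightarrow> 'f::field) \<Rightarrow> 'a \<times> ('a \<Rightarrow> 'f) \<Rightarrow> 'f" where
  "double_form (x, \<xi>) (y, \<eta>) = \<eta> x + \<xi> y"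

fun double_br ::
  "('f::field \<Rightarrow> 'a::ab_group_add \<Rightarrow> 'a) \<Rightarrow> ('a \<Rightarrow> 'a \<Rightarrow> 'a \<Rightarrow> 'a) \<Rightarrow>
    (('a \<Rightarrow> 'f) \<Rightarrow> ('a \<Rightarrow> 'f) \<Rightarrow> ('a \<Rightarrow> 'f) \<Rightarrow> ('a \<Rightarrow> 'f)) \<Rightarrow>
    'a \<times> ('a \<Rightarrow> 'f) \<Rightarrow> 'a \<times> ('a \<Rightarrow> 'f) \<Rightarrow> 'a \<times> ('a \<Rightarrow> 'f) \<Rightarrow> 'a \<times> ('a \<Rightarrow> 'f)" where
  "double_br s br brd (x, \<xi>) (y, \<eta>) (z, \<zeta>) =
     (br x y z + coad_star s brd \<xi> \<eta> z - coad_star s brd \<xi> \<zeta> y + coad_star s brd \<eta> \<zeta> x,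
      ad_star br x y \<zeta> - ad_star br x z \<eta> + ad_star br y z \<xi> + brd \<xi> \<eta> \<zeta>)"

fun double_mul ::
  "('f::field \<Rightarrow> 'a::ab_group_add \<Rightarrow> 'a) \<Rightarrow> ('a \<Rightarrow> 'a \<Rightarrow> 'a) \<Rightarrow>
    (('a \<Rightarrow> 'f) \<Rightarrow> ('a \<Rightarrow> 'f) \<Rightarrow> ('a \<Rightarrow> 'f)) \<Rightarrow>
    'a \<times> ('a \<Rightarrow> 'f) \<Rightarrow> 'a \<times> ('a \<Rightarrow> 'f) \<Rightarrow> 'a \<times> ('a \<Rightarrow> 'f)" where
  "double_mul s mul muld (x, \<xi>) (y, \<eta>) =
     (mul x y - coL_star s muld \<xi> y - coL_star s muld \<eta> x,
      - L_star mul x \<eta> - L_star mul y \<xi> + muld \<xi> \<eta>)"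

definition standard_manin_triple ::
  "('f::field_char_0 \<Rightarrow> 'a::ab_group_add \<Rightarrow> 'a) \<Rightarrow> ('a \<Rightarrow> 'a \<Rightarrow> 'a) \<Rightarrow> ('a \<Rightarrow> 'a \<Rightarrow> 'a \<Rightarrow> 'a) \<Rightarrow>
    (('a \<Rightarrow> 'f) \<Rightarrow> ('a \<Rightarrow> 'f) \<Rightarrow> ('a \<Rightarrow> 'f)) \<Rightarrow>
    (('a \<Rightarrow> 'f) \<Rightarrow> ('a \<Rightarrow> 'f) \<Rightarrow> ('a \<Rightarrow> 'f) \<Rightarrow> ('a \<Rightarrow> 'f)) \<Rightarrow> bool" where
  "standard_manin_triple s mul br muld brd \<longleftrightarrow>
     manin_triple (module_prod.scale s dual_scale) (UNIV \<times> dual_space s)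
       (double_mul s mul muld) (double_br s br brd) double_form
       (UNIV \<times> {0}) ({0} \<times> dual_space s)"

end

theory Submission
  imports Defs
begin

text \<open>
  If two Poisson 3-Lie algebras act on each other, the axioms for the induced operations on the direct
  sum \<open>A \<oplus> B\<close> are multilinear identities, so they need only be checked on arguments from the two
  summands. Sorting these by how many arguments lie in \<open>B\<close> and comparing the components in \<open>A\<close> and \<open>B\<close>
  gives exactly the identities of a matched pair, half of which follow from the other half by exchanging
  \<open>A\<close> and \<open>B\<close>. For the coadjoint actions of \<open>A\<close> and \<open>A\<^sup>*\<close> the direct sum is the double, and everything
  else required of a standard Manin triple holds automatically: invariance of the form is the
  definition of the dual operators.
\<close>

section \<open>Linearity on carriers\<close>

text \<open>The sum operations can be written down for any multilinear actions, and they are then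
  already multilinear and commutative or skew; only the quadratic identities are in question, and
  both sides of the equivalence state them. The bracket is graded modulo 2, with \<open>A\<close>
  even and \<open>B\<close> odd: two arguments from \<open>A\<close> and one from \<open>B\<close>
  land in \<open>B\<close>, two from \<open>B\<close> and one from \<open>A\<close> land in
  \<open>A\<close>. Each type of the fundamental identity therefore lives in a single component and
  gives a single identity. The same grading is the projection condition of a Manin triple. The
  product is not graded, because a product of an element of \<open>A\<close> with one of
  \<open>B\<close> has components in both summands; this is why one type of associativity or of the
  Leibniz rule can give two identities at once. The operators of the dual on the space are defined
  by unique choice. Their defining equation needs the dual basis, and afterwards equations in
  \<open>A\<close> are proved by applying all functionals, equations in the dual by evaluating at
  all vectors.\<close>

lemma linear_onI:
  assumes "\<And>x. x \<in> V \<Longrightarrow> f x \<in> W"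
    and "\<And>x y. x \<in> V \<Longrightarrow> y \<in> V \<Longrightarrow> f (x + y) = f x + f y"
    and "\<And>c x. x \<in> V \<Longrightarrow> f (s c x) = t c (f x)"
  shows "linear_on s V t W f"
  using assms by (simp add: linear_on_def)

lemma linear_on_simps:
  assumes "linear_on s V t W f"
  shows "x \<in> V \<Longrightarrow> f x \<in> W"
    and "x \<in> V \<Longrightarrow> y \<in> V \<Longrightarrow> f (x + y) = f x + f y"
    and "x \<in> V \<Longrightarrow> f (s c x) = t c (f x)"
  using assms by (auto simp: linear_on_def)

lemma linear_on_zero_minus:
  assumes "linear_on s V t W f" and "linear_space s V"
  shows "f 0 = 0" and "x \<in> V \<Longrightarrow> f (- x) = - f x"
proof -
  interpret linear_space s V by fact
  have 0: "0 \<in> V" using subspace_carrier by (simp add: subspace_0)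
  from linear_on_simps(2)[OF assms(1) 0 0] show f0: "f 0 = 0" by simp
  assume x: "x \<in> V"
  then have "- x \<in> V" using subspace_carrier by (simp add: subspace_neg)
  from linear_on_simps(2)[OF assms(1) x this] f0 show "f (- x) = - f x"
    by (simp add: eq_neg_iff_add_eq_0 add.commute)
qed

lemma (in linear_space) carrier_simps:
  shows "0 \<in> V"
    and "x \<in> V \<Longrightarrow> y \<in> V \<Longrightarrow> x + y \<in> V"
    and "x \<in> V \<Longrightarrow> y \<in> V \<Longrightarrow> x - y \<in> V"
    and "x \<in> V \<Longrightarrow> - x \<in> V"
    and "x \<in> V \<Longrightarrow> s c x \<in> V"
  using subspace_carrier
  by (simp_all add: subspace_0 subspace_add subspace_diff subspace_neg subspace_scale)

lemma bilinear_on_simps: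
  assumes "bilinear_on r U s V t W f" and "linear_space r U" and "linear_space s V"
  shows "x \<in> U \<Longrightarrow> y \<in> V \<Longrightarrow> f x y \<in> W"
    and "x \<in> U \<Longrightarrow> x' \<in> U \<Longrightarrow> y \<in> V \<Longrightarrow> f (x + x') y = f x y + f x' y"
    and "x \<in> U \<Longrightarrow> y \<in> V \<Longrightarrow> y' \<in> V \<Longrightarrow> f x (y + y') = f x y + f x y'"
    and "x \<in> U \<Longrightarrow> y \<in> V \<Longrightarrow> f (r c x) y = t c (f x y)"
    and "x \<in> U \<Longrightarrow> y \<in> V \<Longrightarrow> f x (s c y) = t c (f x y)"
    and "y \<in> V \<Longrightarrow> f 0 y = 0"
    and "x \<in> U \<Longrightarrow> f x 0 = 0"
    and "x \<in> U \<Longrightarrow> y \<in> V \<Longrightarrow> f (- x) y = - f x y"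
    and "x \<in> U \<Longrightarrow> y \<in> V \<Longrightarrow> f x (- y) = - f x y"
proof -
  have 1: "linear_on s V t W (f x)" if "x \<in> U" for x
    using assms(1) that by (simp add: bilinear_on_def)
  have 2: "linear_on r U t W (\<lambda>x. f x y)" if "y \<in> V" for y
    using assms(1) that by (simp add: bilinear_on_def)
  show "x \<in> U \<Longrightarrow> y \<in> V \<Longrightarrow> f x y \<in> W"
    and "x \<in> U \<Longrightarrow> x' \<in> U \<Longrightarrow> y \<in> V \<Longrightarrow> f (x + x') y = f x y + f x' y"
    and "x \<in> U \<Longrightarrow> y \<in> V \<Longrightarrow> y' \<in> V \<Longrightarrow> f x (y + y') = f x y + f x y'"
    and "x \<in> U \<Longrightarrow> y \<in> V \<Longrightarrow> f (r c x) y = t c (f x y)"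
    and "x \<in> U \<Longrightarrow> y \<in> V \<Longrightarrow> f x (s c y) = t c (f x y)"
    using linear_on_simps[OF 1] linear_on_simps[OF 2] by blast+
  show "y \<in> V \<Longrightarrow> f 0 y = 0" and "x \<in> U \<Longrightarrow> y \<in> V \<Longrightarrow> f (- x) y = - f x y"
    using linear_on_zero_minus[OF 2 assms(2)] by blast+
  show "x \<in> U \<Longrightarrow> f x 0 = 0" and "x \<in> U \<Longrightarrow> y \<in> V \<Longrightarrow> f x (- y) = - f x y"
    using linear_on_zero_minus[OF 1 assms(3)] by blast+
qed

lemma trilinear_on_simps:
  assumes "trilinear_on r U s V t W q Z f"
    and "linear_space r U" and "linear_space s V" and "linear_space t W"
  shows "x \<in> U \<Longrightarrow> y \<in> V \<Longrightarrow> z \<in> W \<Longrightarrow> f x y z \<in> Z"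
    and "x \<in> U \<Longrightarrow> x' \<in> U \<Longrightarrow> y \<in> V \<Longrightarrow> z \<in> W \<Longrightarrow> f (x + x') y z = f x y z + f x' y z"
    and "x \<in> U \<Longrightarrow> y \<in> V \<Longrightarrow> y' \<in> V \<Longrightarrow> z \<in> W \<Longrightarrow> f x (y + y') z = f x y z + f x y' z"
    and "x \<in> U \<Longrightarrow> y \<in> V \<Longrightarrow> z \<in> W \<Longrightarrow> z' \<in> W \<Longrightarrow> f x y (z + z') = f x y z + f x y z'"
    and "x \<in> U \<Longrightarrow> y \<in> V \<Longrightarrow> z \<in> W \<Longrightarrow> f (r c x) y z = q c (f x y z)"
    and "x \<in> U \<Longrightarrow> y \<in> V \<Longrightarrow> z \<in> W \<Longrightarrow> f x (s c y) z = q c (f x y z)"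
    and "x \<in> U \<Longrightarrow> y \<in> V \<Longrightarrow> z \<in> W \<Longrightarrow> f x y (t c z) = q c (f x y z)"
    and "y \<in> V \<Longrightarrow> z \<in> W \<Longrightarrow> f 0 y z = 0"
    and "x \<in> U \<Longrightarrow> z \<in> W \<Longrightarrow> f x 0 z = 0"
    and "x \<in> U \<Longrightarrow> y \<in> V \<Longrightarrow> f x y 0 = 0"
    and "x \<in> U \<Longrightarrow> y \<in> V \<Longrightarrow> z \<in> W \<Longrightarrow> f (- x) y z = - f x y z"
    and "x \<in> U \<Longrightarrow> y \<in> V \<Longrightarrow> z \<in> W \<Longrightarrow> f x (- y) z = - f x y z"
    and "x \<in> U \<Longrightarrow> y \<in> V \<Longrightarrow> z \<in> W \<Longrightarrow> f x y (- z) = - f x y z"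
proof -
  have 1: "linear_on t W q Z (f x y)" if "x \<in> U" "y \<in> V" for x y
    using assms(1) that by (simp add: trilinear_on_def)
  have 2: "linear_on s V q Z (\<lambda>y. f x y z)" if "x \<in> U" "z \<in> W" for x z
    using assms(1) that by (simp add: trilinear_on_def)
  have 3: "linear_on r U q Z (\<lambda>x. f x y z)" if "y \<in> V" "z \<in> W" for y z
    using assms(1) that by (simp add: trilinear_on_def)
  show "x \<in> U \<Longrightarrow> y \<in> V \<Longrightarrow> z \<in> W \<Longrightarrow> f x y z \<in> Z"
    and "x \<in> U \<Longrightarrow> x' \<in> U \<Longrightarrow> y \<in> V \<Longrightarrow> z \<in> W \<Longrightarrow> f (x + x') y z = f x y z + f x' y z"
    and "x \<in> U \<Longrightarrow> y \<in> V \<Longrightarrow> y' \<in> V \<Longrightarrow> z \<in> W \<Longrightarrow> f x (y + y') z = f x y z + f x y' z"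
    and "x \<in> U \<Longrightarrow> y \<in> V \<Longrightarrow> z \<in> W \<Longrightarrow> z' \<in> W \<Longrightarrow> f x y (z + z') = f x y z + f x y z'"
    and "x \<in> U \<Longrightarrow> y \<in> V \<Longrightarrow> z \<in> W \<Longrightarrow> f (r c x) y z = q c (f x y z)"
    and "x \<in> U \<Longrightarrow> y \<in> V \<Longrightarrow> z \<in> W \<Longrightarrow> f x (s c y) z = q c (f x y z)"
    and "x \<in> U \<Longrightarrow> y \<in> V \<Longrightarrow> z \<in> W \<Longrightarrow> f x y (t c z) = q c (f x y z)"
    by (simp_all add: linear_on_simps[OF 1] linear_on_simps[OF 2] linear_on_simps[OF 3])
  show "y \<in> V \<Longrightarrow> z \<in> W \<Longrightarrow> f 0 y z = 0"
    and "x \<in> U \<Longrightarrow> y \<in> V \<Longrightarrow> z \<in> W \<Longrightarrow> f (- x) y z = - f x y z"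
    using linear_on_zero_minus[OF 3 assms(2)] by blast+
  show "x \<in> U \<Longrightarrow> z \<in> W \<Longrightarrow> f x 0 z = 0"
    and "x \<in> U \<Longrightarrow> y \<in> V \<Longrightarrow> z \<in> W \<Longrightarrow> f x (- y) z = - f x y z"
    using linear_on_zero_minus[OF 2 assms(3)] by blast+
  show "x \<in> U \<Longrightarrow> y \<in> V \<Longrightarrow> f x y 0 = 0"
    and "x \<in> U \<Longrightarrow> y \<in> V \<Longrightarrow> z \<in> W \<Longrightarrow> f x y (- z) = - f x y z"
    using linear_on_zero_minus[OF 1 assms(4)] by blast+
qed

lemma linear_space_Times:
  assumes "linear_space sA A" and "linear_space sB B"
  shows "linear_space (module_prod.scale sA sB) (A \<times> B)"
proof -
  interpret A: linear_space sA A by fact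
  interpret B: linear_space sB B by fact
  interpret vector_space_prod sA sB ..
  show ?thesis
    by unfold_locales (intro subspace_Times A.subspace_carrier B.subspace_carrier)
qed

lemma prod_scale_Pair:
  assumes "linear_space sA A" and "linear_space sB B"
  shows "module_prod.scale sA sB c (x, y) = (sA c x, sB c y)"
proof -
  interpret A: linear_space sA A by fact
  interpret B: linear_space sB B by fact
  interpret vector_space_prod sA sB ..
  show ?thesis by (simp add: scale_prod)
qed


section \<open>Reduction of the identities to generators\<close>

text \<open>Every argument has its own range, so that "the identity holds for arguments of a given
  type" is a formula that can be permuted and split slot by slot.\<close>

definition fund_on :: "('v::ab_group_add \<Rightarrow> 'v \<Rightarrow> 'v \<Rightarrow> 'v) \<Rightarrow>
    'v set \<Rightarrow> 'v set \<Rightarrow> 'v set \<Rightarrow> 'v set \<Rightarrow> 'v set \<Rightarrow> bool" where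
  "fund_on br S1 S2 S3 S4 S5 \<longleftrightarrow>
    (\<forall>x1\<in>S1. \<forall>x2\<in>S2. \<forall>x3\<in>S3. \<forall>x4\<in>S4. \<forall>x5\<in>S5. br x1 x2 (br x3 x4 x5) =
      br (br x1 x2 x3) x4 x5 + br x3 (br x1 x2 x4) x5 + br x3 x4 (br x1 x2 x5))"

definition leibniz_on :: "('v::ab_group_add \<Rightarrow> 'v \<Rightarrow> 'v) \<Rightarrow> ('v \<Rightarrow> 'v \<Rightarrow> 'v \<Rightarrow> 'v) \<Rightarrow>
    'v set \<Rightarrow> 'v set \<Rightarrow> 'v set \<Rightarrow> 'v set \<Rightarrow> bool" where
  "leibniz_on mul br S1 S2 S3 S4 \<longleftrightarrow>
    (\<forall>w\<in>S1. \<forall>x\<in>S2. \<forall>y\<in>S3. \<forall>z\<in>S4. br (mul w x) y z = mul w (br x y z) + mul x (br w y z))"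

definition assoc_on :: "('v \<Rightarrow> 'v \<Rightarrow> 'v) \<Rightarrow> 'v set \<Rightarrow> 'v set \<Rightarrow> 'v set \<Rightarrow> bool" where
  "assoc_on mul S1 S2 S3 \<longleftrightarrow> (\<forall>x\<in>S1. \<forall>y\<in>S2. \<forall>z\<in>S3. mul (mul x y) z = mul x (mul y z))"

text \<open>Up to the symmetries of the identities, these are the types with at least half of the arguments in
  \<open>U\<close>; the others arise by exchanging \<open>U\<close> and \<open>W\<close>. The type \<open>(U, W, U)\<close> is missing for associativity
  because commutativity reduces it to \<open>(U, U, W)\<close>.\<close>

definition fund_half :: "('v::ab_group_add \<Rightarrow> 'v \<Rightarrow> 'v \<Rightarrow> 'v) \<Rightarrow> 'v set \<Rightarrow> 'v set \<Rightarrow> bool" where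
  "fund_half br U W \<longleftrightarrow>
    fund_on br U U U U U \<and> fund_on br U U U U W \<and> fund_on br U W U U U \<and>
    fund_on br W W U U U \<and> fund_on br U U U W W \<and> fund_on br U W U U W"

definition leibniz_half :: "('v::ab_group_add \<Rightarrow> 'v \<Rightarrow> 'v) \<Rightarrow> ('v \<Rightarrow> 'v \<Rightarrow> 'v \<Rightarrow> 'v) \<Rightarrow>
    'v set \<Rightarrow> 'v set \<Rightarrow> bool" where
  "leibniz_half mul br U W \<longleftrightarrow>
    leibniz_on mul br U U U U \<and> leibniz_on mul br U U U W \<and> leibniz_on mul br U U W W \<and>
    leibniz_on mul br U W U U \<and> leibniz_on mul br U W U W"

definition assoc_half :: "('v \<Rightarrow> 'v \<Rightarrow> 'v) \<Rightarrow> 'v set \<Rightarrow> 'v set \<Rightarrow> bool" where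
  "assoc_half mul U W \<longleftrightarrow> assoc_on mul U U U \<and> assoc_on mul U U W"

section \<open>The fundamental identity of a skew trilinear bracket\<close>

locale skew_trilinear = linear_space s V
  for s :: "'f::field_char_0 \<Rightarrow> 'v::ab_group_add \<Rightarrow> 'v" and V +
  fixes br :: "'v \<Rightarrow> 'v \<Rightarrow> 'v \<Rightarrow> 'v"
  assumes trilinear: "trilinear_on s V s V s V s V br"
    and skew12: "\<lbrakk>x \<in> V; y \<in> V; z \<in> V\<rbrakk> \<Longrightarrow> br y x z = - br x y z"
    and skew23: "\<lbrakk>x \<in> V; y \<in> V; z \<in> V\<rbrakk> \<Longrightarrow> br x z y = - br x y z"
begin

lemmas br_simps = trilinear_on_simps[OF trilinear linear_space_axioms linear_space_axioms linear_space_axioms]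

text \<open>The locale contains all axioms of a 3-Lie algebra except the quadratic one. It is what
  the bracket of the direct sum satisfies for arbitrary skew actions.\<close>

lemma three_lie_iff_fund_on: "three_lie_algebra s V br \<longleftrightarrow> fund_on br V V V V V"
  using linear_space_axioms trilinear skew12 skew23
  unfolding three_lie_algebra_def three_lie_algebra_axioms_def fund_on_def by blast

text \<open>All four terms contain the outer pair exactly once inside a bracket, so all of them
  change sign.\<close>

lemma fund_on_swap12:
  assumes "fund_on br S1 S2 S3 S4 S5" "S1 \<subseteq> V" "S2 \<subseteq> V" "S3 \<subseteq> V" "S4 \<subseteq> V" "S5 \<subseteq> V"
  shows "fund_on br S2 S1 S3 S4 S5"
  unfolding fund_on_def
proof (intro ballI)
  fix x2 x1 x3 x4 x5 assume S: "x1 \<in> S1" "x2 \<in> S2" "x3 \<in> S3" "x4 \<in> S4" "x5 \<in> S5"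
  with assms have V: "x1 \<in> V" "x2 \<in> V" "x3 \<in> V" "x4 \<in> V" "x5 \<in> V" by auto
  from assms(1) S have "br x1 x2 (br x3 x4 x5) =
      br (br x1 x2 x3) x4 x5 + br x3 (br x1 x2 x4) x5 + br x3 x4 (br x1 x2 x5)"
    by (simp add: fund_on_def)
  with V show "br x2 x1 (br x3 x4 x5) =
      br (br x2 x1 x3) x4 x5 + br x3 (br x2 x1 x4) x5 + br x3 x4 (br x2 x1 x5)"
    by (simp add: skew12[of x1 x2] br_simps)
qed

text \<open>Exchanging \<open>x3\<close> and \<open>x4\<close> negates the left side; on the right
  it negates the terms and interchanges the first two. In \<open>fund_on_swap45\<close> the last two
  are interchanged instead.\<close>

lemma fund_on_swap34:
  assumes "fund_on br S1 S2 S3 S4 S5" "S1 \<subseteq> V" "S2 \<subseteq> V" "S3 \<subseteq> V" "S4 \<subseteq> V" "S5 \<subseteq> V"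
  shows "fund_on br S1 S2 S4 S3 S5"
  unfolding fund_on_def
proof (intro ballI)
  fix x1 x2 x4 x3 x5 assume S: "x1 \<in> S1" "x2 \<in> S2" "x3 \<in> S3" "x4 \<in> S4" "x5 \<in> S5"
  with assms have V: "x1 \<in> V" "x2 \<in> V" "x3 \<in> V" "x4 \<in> V" "x5 \<in> V" by auto
  from assms(1) S have "br x1 x2 (br x3 x4 x5) =
      br (br x1 x2 x3) x4 x5 + br x3 (br x1 x2 x4) x5 + br x3 x4 (br x1 x2 x5)"
    by (simp add: fund_on_def)
  with V show "br x1 x2 (br x4 x3 x5) =
      br (br x1 x2 x4) x3 x5 + br x4 (br x1 x2 x3) x5 + br x4 x3 (br x1 x2 x5)"
    by (simp add: skew12[of x3 x4] skew12[of x3 "br x1 x2 x4"] skew12[of "br x1 x2 x3" x4] br_simps)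
qed

lemma fund_on_swap45:
  assumes "fund_on br S1 S2 S3 S4 S5" "S1 \<subseteq> V" "S2 \<subseteq> V" "S3 \<subseteq> V" "S4 \<subseteq> V" "S5 \<subseteq> V"
  shows "fund_on br S1 S2 S3 S5 S4"
  unfolding fund_on_def
proof (intro ballI)
  fix x1 x2 x4 x3 x5 assume S: "x1 \<in> S1" "x2 \<in> S2" "x3 \<in> S3" "x4 \<in> S4" "x5 \<in> S5"
  with assms have V: "x1 \<in> V" "x2 \<in> V" "x3 \<in> V" "x4 \<in> V" "x5 \<in> V" by auto
  from assms(1) S have "br x1 x2 (br x3 x4 x5) =
      br (br x1 x2 x3) x4 x5 + br x3 (br x1 x2 x4) x5 + br x3 x4 (br x1 x2 x5)"
    by (simp add: fund_on_def)
  with V show "br x1 x2 (br x3 x5 x4) =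
      br (br x1 x2 x3) x5 x4 + br x3 (br x1 x2 x5) x4 + br x3 x5 (br x1 x2 x4)"
    by (simp add: skew23[of _ x4 x5] skew23[of x3 "br x1 x2 x4" x5] skew23[of x3 x4 "br x1 x2 x5"] br_simps)
qed

context
  fixes U W :: "'v set"
  assumes decomp: "V = {u + w |u w. u \<in> U \<and> w \<in> W}" and sub: "U \<subseteq> V" "W \<subseteq> V"
begin

text \<open>Both sides are additive in each argument, and each argument in \<open>V\<close> is a sum
  from \<open>U\<close> and \<open>W\<close>. The other ranges are arbitrary subsets of
  \<open>V\<close>, so the slots can be split one after another.\<close>

lemma fund_on_decomp:
  shows "\<lbrakk>S2 \<subseteq> V; S3 \<subseteq> V; S4 \<subseteq> V; S5 \<subseteq> V;
      fund_on br U S2 S3 S4 S5; fund_on br W S2 S3 S4 S5\<rbrakk>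
    \<Longrightarrow> fund_on br V S2 S3 S4 S5"
  and "\<lbrakk>S1 \<subseteq> V; S3 \<subseteq> V; S4 \<subseteq> V; S5 \<subseteq> V;
      fund_on br S1 U S3 S4 S5; fund_on br S1 W S3 S4 S5\<rbrakk>
    \<Longrightarrow> fund_on br S1 V S3 S4 S5"
  and "\<lbrakk>S1 \<subseteq> V; S2 \<subseteq> V; S4 \<subseteq> V; S5 \<subseteq> V;
      fund_on br S1 S2 U S4 S5; fund_on br S1 S2 W S4 S5\<rbrakk>
    \<Longrightarrow> fund_on br S1 S2 V S4 S5"
  and "\<lbrakk>S1 \<subseteq> V; S2 \<subseteq> V; S3 \<subseteq> V; S5 \<subseteq> V;
      fund_on br S1 S2 S3 U S5; fund_on br S1 S2 S3 W S5\<rbrakk>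
    \<Longrightarrow> fund_on br S1 S2 S3 V S5"
  and "\<lbrakk>S1 \<subseteq> V; S2 \<subseteq> V; S3 \<subseteq> V; S4 \<subseteq> V;
      fund_on br S1 S2 S3 S4 U; fund_on br S1 S2 S3 S4 W\<rbrakk>
    \<Longrightarrow> fund_on br S1 S2 S3 S4 V"
proof -
  note decompE = decomp[THEN equalityD1, THEN subsetD, unfolded mem_Collect_eq]
  note S = sub[THEN subsetD]
  show "fund_on br V S2 S3 S4 S5"
    if S': "S2 \<subseteq> V" "S3 \<subseteq> V" "S4 \<subseteq> V" "S5 \<subseteq> V"
      and hyp: "fund_on br U S2 S3 S4 S5" "fund_on br W S2 S3 S4 S5"
    unfolding fund_on_def
  proof (intro ballI)
    fix x1 x2 x3 x4 x5 assume x: "x1 \<in> V" "x2 \<in> S2" "x3 \<in> S3" "x4 \<in> S4" "x5 \<in> S5"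
    obtain u w where uw: "u \<in> U" "w \<in> W" and decx: "x1 = u + w" using decompE[OF x(1)] by blast
    have "br u x2 (br x3 x4 x5) =
      br (br u x2 x3) x4 x5 + br x3 (br u x2 x4) x5 + br x3 x4 (br u x2 x5)" and "br w x2 (br x3 x4 x5) =
      br (br w x2 x3) x4 x5 + br x3 (br w x2 x4) x5 + br x3 x4 (br w x2 x5)"
      using hyp uw x by (simp_all add: fund_on_def)
    with uw x S S'[THEN subsetD] show "br x1 x2 (br x3 x4 x5) =
      br (br x1 x2 x3) x4 x5 + br x3 (br x1 x2 x4) x5 + br x3 x4 (br x1 x2 x5)"
      by (simp add: decx br_simps)
  qed
  show "fund_on br S1 V S3 S4 S5"
    if S': "S1 \<subseteq> V" "S3 \<subseteq> V" "S4 \<subseteq> V" "S5 \<subseteq> V"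
      and hyp: "fund_on br S1 U S3 S4 S5" "fund_on br S1 W S3 S4 S5"
    unfolding fund_on_def
  proof (intro ballI)
    fix x1 x2 x3 x4 x5 assume x: "x1 \<in> S1" "x2 \<in> V" "x3 \<in> S3" "x4 \<in> S4" "x5 \<in> S5"
    obtain u w where uw: "u \<in> U" "w \<in> W" and decx: "x2 = u + w" using decompE[OF x(2)] by blast
    have "br x1 u (br x3 x4 x5) =
      br (br x1 u x3) x4 x5 + br x3 (br x1 u x4) x5 + br x3 x4 (br x1 u x5)" and "br x1 w (br x3 x4 x5) =
      br (br x1 w x3) x4 x5 + br x3 (br x1 w x4) x5 + br x3 x4 (br x1 w x5)"
      using hyp uw x by (simp_all add: fund_on_def)
    with uw x S S'[THEN subsetD] show "br x1 x2 (br x3 x4 x5) =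
      br (br x1 x2 x3) x4 x5 + br x3 (br x1 x2 x4) x5 + br x3 x4 (br x1 x2 x5)"
      by (simp add: decx br_simps)
  qed
  show "fund_on br S1 S2 V S4 S5"
    if S': "S1 \<subseteq> V" "S2 \<subseteq> V" "S4 \<subseteq> V" "S5 \<subseteq> V"
      and hyp: "fund_on br S1 S2 U S4 S5" "fund_on br S1 S2 W S4 S5"
    unfolding fund_on_def
  proof (intro ballI)
    fix x1 x2 x3 x4 x5 assume x: "x1 \<in> S1" "x2 \<in> S2" "x3 \<in> V" "x4 \<in> S4" "x5 \<in> S5"
    obtain u w where uw: "u \<in> U" "w \<in> W" and decx: "x3 = u + w" using decompE[OF x(3)] by blast
    have "br x1 x2 (br u x4 x5) =
      br (br x1 x2 u) x4 x5 + br u (br x1 x2 x4) x5 + br u x4 (br x1 x2 x5)" and "br x1 x2 (br w x4 x5) =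
      br (br x1 x2 w) x4 x5 + br w (br x1 x2 x4) x5 + br w x4 (br x1 x2 x5)"
      using hyp uw x by (simp_all add: fund_on_def)
    with uw x S S'[THEN subsetD] show "br x1 x2 (br x3 x4 x5) =
      br (br x1 x2 x3) x4 x5 + br x3 (br x1 x2 x4) x5 + br x3 x4 (br x1 x2 x5)"
      by (simp add: decx br_simps)
  qed
  show "fund_on br S1 S2 S3 V S5"
    if S': "S1 \<subseteq> V" "S2 \<subseteq> V" "S3 \<subseteq> V" "S5 \<subseteq> V"
      and hyp: "fund_on br S1 S2 S3 U S5" "fund_on br S1 S2 S3 W S5"
    unfolding fund_on_def
  proof (intro ballI)
    fix x1 x2 x3 x4 x5 assume x: "x1 \<in> S1" "x2 \<in> S2" "x3 \<in> S3" "x4 \<in> V" "x5 \<in> S5"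
    obtain u w where uw: "u \<in> U" "w \<in> W" and decx: "x4 = u + w" using decompE[OF x(4)] by blast
    have "br x1 x2 (br x3 u x5) =
      br (br x1 x2 x3) u x5 + br x3 (br x1 x2 u) x5 + br x3 u (br x1 x2 x5)" and "br x1 x2 (br x3 w x5) =
      br (br x1 x2 x3) w x5 + br x3 (br x1 x2 w) x5 + br x3 w (br x1 x2 x5)"
      using hyp uw x by (simp_all add: fund_on_def)
    with uw x S S'[THEN subsetD] show "br x1 x2 (br x3 x4 x5) =
      br (br x1 x2 x3) x4 x5 + br x3 (br x1 x2 x4) x5 + br x3 x4 (br x1 x2 x5)"
      by (simp add: decx br_simps)
  qed
  show "fund_on br S1 S2 S3 S4 V"
    if S': "S1 \<subseteq> V" "S2 \<subseteq> V" "S3 \<subseteq> V" "S4 \<subseteq> V"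
      and hyp: "fund_on br S1 S2 S3 S4 U" "fund_on br S1 S2 S3 S4 W"
    unfolding fund_on_def
  proof (intro ballI)
    fix x1 x2 x3 x4 x5 assume x: "x1 \<in> S1" "x2 \<in> S2" "x3 \<in> S3" "x4 \<in> S4" "x5 \<in> V"
    obtain u w where uw: "u \<in> U" "w \<in> W" and decx: "x5 = u + w" using decompE[OF x(5)] by blast
    have "br x1 x2 (br x3 x4 u) =
      br (br x1 x2 x3) x4 u + br x3 (br x1 x2 x4) u + br x3 x4 (br x1 x2 u)" and "br x1 x2 (br x3 x4 w) =
      br (br x1 x2 x3) x4 w + br x3 (br x1 x2 x4) w + br x3 x4 (br x1 x2 w)"
      using hyp uw x by (simp_all add: fund_on_def)
    with uw x S S'[THEN subsetD] show "br x1 x2 (br x3 x4 x5) =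
      br (br x1 x2 x3) x4 x5 + br x3 (br x1 x2 x4) x5 + br x3 x4 (br x1 x2 x5)"
      by (simp add: decx br_simps)
  qed
qed

text \<open>By the swaps a type is determined by the number \<open>k\<close> of
  \<open>W\<close>-arguments in the outer pair and the number \<open>l\<close> among the inner
  three. Of these twelve types, the six with \<open>k + l \<le> 2\<close> form
  \<open>fund_half br U W\<close>, and the other six form \<open>fund_half br W U\<close>.\<close>

lemma fund_on_iff_halves:
  "fund_on br V V V V V \<longleftrightarrow> fund_half br U W \<and> fund_half br W U"
proof
  assume "fund_on br V V V V V"
  then show "fund_half br U W \<and> fund_half br W U"
    unfolding fund_half_def fund_on_def using sub by blast
next
  assume half: "fund_half br U W \<and> fund_half br W U"
  \<comment> \<open>Booleans code the summands, which makes the 32 types a finite case split in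
    which the three swaps act on the codes.\<close>
  define S where "S b = (if b then U else W)" for b
  have SV: "S b \<subseteq> V" for b using sub by (simp add: S_def)
  have 12: "fund_on br (S a) (S b) (S c) (S d) (S e) \<Longrightarrow> fund_on br (S b) (S a) (S c) (S d) (S e)"
    and 34: "fund_on br (S a) (S b) (S c) (S d) (S e) \<Longrightarrow> fund_on br (S a) (S b) (S d) (S c) (S e)"
    and 45: "fund_on br (S a) (S b) (S c) (S d) (S e) \<Longrightarrow> fund_on br (S a) (S b) (S c) (S e) (S d)"
    for a b c d e
    by (erule fund_on_swap12 fund_on_swap34 fund_on_swap45; simp only: SV)+
  have gen: "fund_on br (S a) (S b) (S c) (S d) (S e)" for a b c d e
  proof -
    have "U = S True" "W = S False" by (simp_all add: S_def)
    with half have *: "fund_half br (S True) (S False)" "fund_half br (S False) (S True)" by auto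
    show ?thesis
      using *[unfolded fund_half_def]
      by (cases a; cases b; cases c; cases d; cases e) (metis 12 34 45)+
  qed
  \<comment> \<open>Restated without the code, in the form in which the goals appear once all five
    copies of \<open>V\<close> have been split.\<close>
  have "fund_on br X1 X2 X3 X4 X5" if "X1 \<in> {U, W}" "X2 \<in> {U, W}" "X3 \<in> {U, W}" "X4 \<in> {U, W}" "X5 \<in> {U, W}"
    for X1 X2 X3 X4 X5
  proof -
    have "\<exists>b. X = S b" if "X \<in> {U, W}" for X
      using that unfolding S_def by (metis insertE singletonD)
    with that gen show ?thesis by metis
  qed
  then show "fund_on br V V V V V"
    by (intro fund_on_decomp subset_refl sub) simp_all
qed

end

end

section \<open>Associativity of a commutative bilinear product\<close>

locale comm_bilinear = linear_space s V
  for s :: "'f::field_char_0 \<Rightarrow> 'v::ab_group_add \<Rightarrow> 'v" and V +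
  fixes mul :: "'v \<Rightarrow> 'v \<Rightarrow> 'v"
  assumes bilinear: "bilinear_on s V s V s V mul"
    and commute: "\<lbrakk>x \<in> V; y \<in> V\<rbrakk> \<Longrightarrow> mul x y = mul y x"
begin

lemmas mul_simps = bilinear_on_simps[OF bilinear linear_space_axioms linear_space_axioms]

lemma comm_assoc_iff_assoc_on: "comm_assoc_algebra s V mul \<longleftrightarrow> assoc_on mul V V V"
  using linear_space_axioms bilinear commute
  unfolding comm_assoc_algebra_def comm_assoc_algebra_axioms_def assoc_on_def by blast

text \<open>Commutativity reads both bracketings backwards, which interchanges the two sides of the
  identity.\<close>

lemma assoc_on_reverse:
  assumes "assoc_on mul S1 S2 S3" "S1 \<subseteq> V" "S2 \<subseteq> V" "S3 \<subseteq> V"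
  shows "assoc_on mul S3 S2 S1"
  unfolding assoc_on_def
proof (intro ballI)
  fix z y x assume S: "x \<in> S1" "y \<in> S2" "z \<in> S3"
  with assms have V: "x \<in> V" "y \<in> V" "z \<in> V" by auto
  have "mul (mul z y) x = mul x (mul y z)"
    using V by (simp add: commute[of "mul y z" x] commute[of z y] mul_simps)
  also have "\<dots> = mul (mul x y) z"
    using assms(1) S by (simp add: assoc_on_def)
  also have "\<dots> = mul z (mul y x)"
    using V by (simp add: commute[of "mul y x" z] commute[of x y] mul_simps)
  finally show "mul (mul z y) x = mul z (mul y x)" .
qed

text \<open>Move \<open>y\<close> to the front, reassociate with \<open>z\<close> in last place,
  exchange \<open>x\<close> and \<open>y\<close>, reassociate again. Both uses of associativity have
  \<open>z\<close> last, as in the two assumptions.\<close>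

lemma assoc_on_middle:
  assumes "assoc_on mul S1 S2 S3" "assoc_on mul S2 S1 S3" "S1 \<subseteq> V" "S2 \<subseteq> V" "S3 \<subseteq> V"
  shows "assoc_on mul S1 S3 S2"
  unfolding assoc_on_def
proof (intro ballI)
  fix x z y assume S: "x \<in> S1" "y \<in> S2" "z \<in> S3"
  with assms have V: "x \<in> V" "y \<in> V" "z \<in> V" by auto
  have "mul (mul x z) y = mul y (mul x z)"
    using V by (simp add: commute[of "mul x z" y] mul_simps)
  also have "\<dots> = mul (mul y x) z"
    using assms(2) S by (simp add: assoc_on_def)
  also have "\<dots> = mul (mul x y) z"
    using V by (simp add: commute[of x y])
  also have "\<dots> = mul x (mul y z)"
    using assms(1) S by (simp add: assoc_on_def)
  also have "\<dots> = mul x (mul z y)"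
    using V by (simp add: commute[of y z])
  finally show "mul (mul x z) y = mul x (mul z y)" .
qed

context
  fixes U W :: "'v set"
  assumes decomp: "V = {u + w |u w. u \<in> U \<and> w \<in> W}" and sub: "U \<subseteq> V" "W \<subseteq> V"
begin

lemma assoc_on_decomp:
  shows "\<lbrakk>S2 \<subseteq> V; S3 \<subseteq> V; assoc_on mul U S2 S3; assoc_on mul W S2 S3\<rbrakk>
    \<Longrightarrow> assoc_on mul V S2 S3"
  and "\<lbrakk>S1 \<subseteq> V; S3 \<subseteq> V; assoc_on mul S1 U S3; assoc_on mul S1 W S3\<rbrakk>
    \<Longrightarrow> assoc_on mul S1 V S3"
  and "\<lbrakk>S1 \<subseteq> V; S2 \<subseteq> V; assoc_on mul S1 S2 U; assoc_on mul S1 S2 W\<rbrakk>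
    \<Longrightarrow> assoc_on mul S1 S2 V"
proof -
  note decompE = decomp[THEN equalityD1, THEN subsetD, unfolded mem_Collect_eq]
  note S = sub[THEN subsetD]
  show "assoc_on mul V S2 S3"
    if S': "S2 \<subseteq> V" "S3 \<subseteq> V"
      and hyp: "assoc_on mul U S2 S3" "assoc_on mul W S2 S3"
    unfolding assoc_on_def
  proof (intro ballI)
    fix x y z assume x: "x \<in> V" "y \<in> S2" "z \<in> S3"
    obtain u u' where uw: "u \<in> U" "u' \<in> W" and decx: "x = u + u'" using decompE[OF x(1)] by blast
    have "mul (mul u y) z = mul u (mul y z)"
      and "mul (mul u' y) z = mul u' (mul y z)"
      using hyp uw x by (simp_all add: assoc_on_def)
    with uw x S S'[THEN subsetD] show "mul (mul x y) z = mul x (mul y z)"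
      by (simp add: decx mul_simps)
  qed
  show "assoc_on mul S1 V S3"
    if S': "S1 \<subseteq> V" "S3 \<subseteq> V"
      and hyp: "assoc_on mul S1 U S3" "assoc_on mul S1 W S3"
    unfolding assoc_on_def
  proof (intro ballI)
    fix x y z assume x: "x \<in> S1" "y \<in> V" "z \<in> S3"
    obtain u u' where uw: "u \<in> U" "u' \<in> W" and decx: "y = u + u'" using decompE[OF x(2)] by blast
    have "mul (mul x u) z = mul x (mul u z)"
      and "mul (mul x u') z = mul x (mul u' z)"
      using hyp uw x by (simp_all add: assoc_on_def)
    with uw x S S'[THEN subsetD] show "mul (mul x y) z = mul x (mul y z)"
      by (simp add: decx mul_simps)
  qed
  show "assoc_on mul S1 S2 V"
    if S': "S1 \<subseteq> V" "S2 \<subseteq> V"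
      and hyp: "assoc_on mul S1 S2 U" "assoc_on mul S1 S2 W"
    unfolding assoc_on_def
  proof (intro ballI)
    fix x y z assume x: "x \<in> S1" "y \<in> S2" "z \<in> V"
    obtain u u' where uw: "u \<in> U" "u' \<in> W" and decx: "z = u + u'" using decompE[OF x(3)] by blast
    have "mul (mul x y) u = mul x (mul y u)"
      and "mul (mul x y) u' = mul x (mul y u')"
      using hyp uw x by (simp_all add: assoc_on_def)
    with uw x S S'[THEN subsetD] show "mul (mul x y) z = mul x (mul y z)"
      by (simp add: decx mul_simps)
  qed
qed

lemma assoc_on_iff_halves:
  "assoc_on mul V V V \<longleftrightarrow> assoc_half mul U W \<and> assoc_half mul W U"
proof
  assume "assoc_on mul V V V"
  then show "assoc_half mul U W \<and> assoc_half mul W U"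
    unfolding assoc_half_def assoc_on_def using sub by blast
next
  assume half: "assoc_half mul U W \<and> assoc_half mul W U"
  then have 1: "assoc_on mul U U U" "assoc_on mul U U W" "assoc_on mul W W W" "assoc_on mul W W U"
    by (auto simp: assoc_half_def)
  moreover have "assoc_on mul W U U" "assoc_on mul U W W"
    using 1 sub assoc_on_reverse by blast+
  \<comment> \<open>For the type \<open>(U, W, U)\<close> the two assumptions of
    \<open>assoc_on_middle\<close> coincide: both are the type \<open>(U, U, W)\<close>.\<close>
  moreover have "assoc_on mul U W U" "assoc_on mul W U W"
    using 1 sub assoc_on_middle by blast+
  ultimately show "assoc_on mul V V V"
    by (intro assoc_on_decomp subset_refl sub)
qed

end

end

section \<open>The Leibniz rule\<close>

locale comm_bilinear_skew_trilinear = comm_bilinear s V mul + skew_trilinear s V br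
  for s :: "'f::field_char_0 \<Rightarrow> 'v::ab_group_add \<Rightarrow> 'v" and V mul br
begin

lemma poisson_three_lie_iff_on:
  "poisson_three_lie_algebra s V mul br \<longleftrightarrow>
    assoc_on mul V V V \<and> fund_on br V V V V V \<and> leibniz_on mul br V V V V"
  unfolding comm_assoc_iff_assoc_on[symmetric] three_lie_iff_fund_on[symmetric]
    poisson_three_lie_algebra_def poisson_three_lie_algebra_axioms_def leibniz_on_def
  by blast

lemma leibniz_on_swap12:
  assumes "leibniz_on mul br S1 S2 S3 S4" "S1 \<subseteq> V" "S2 \<subseteq> V" "S3 \<subseteq> V" "S4 \<subseteq> V"
  shows "leibniz_on mul br S2 S1 S3 S4"
  unfolding leibniz_on_def
proof (intro ballI)
  fix x w y z assume S: "w \<in> S1" "x \<in> S2" "y \<in> S3" "z \<in> S4"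
  with assms have V: "w \<in> V" "x \<in> V" by auto
  from assms(1) S have "br (mul w x) y z = mul w (br x y z) + mul x (br w y z)"
    by (simp add: leibniz_on_def)
  with V show "br (mul x w) y z = mul x (br w y z) + mul w (br x y z)"
    by (simp add: commute[of x w])
qed

lemma leibniz_on_swap34:
  assumes "leibniz_on mul br S1 S2 S3 S4" "S1 \<subseteq> V" "S2 \<subseteq> V" "S3 \<subseteq> V" "S4 \<subseteq> V"
  shows "leibniz_on mul br S1 S2 S4 S3"
  unfolding leibniz_on_def
proof (intro ballI)
  fix w x z y assume S: "w \<in> S1" "x \<in> S2" "y \<in> S3" "z \<in> S4"
  with assms have V: "w \<in> V" "x \<in> V" "y \<in> V" "z \<in> V" by auto
  from assms(1) S have "br (mul w x) y z = mul w (br x y z) + mul x (br w y z)"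
    by (simp add: leibniz_on_def)
  with V show "br (mul w x) z y = mul w (br x z y) + mul x (br w z y)"
    by (simp add: skew23[of _ y z] mul_simps br_simps)
qed

context
  fixes U W :: "'v set"
  assumes decomp: "V = {u + w |u w. u \<in> U \<and> w \<in> W}" and sub: "U \<subseteq> V" "W \<subseteq> V"
begin

lemma leibniz_on_decomp:
  shows "\<lbrakk>S2 \<subseteq> V; S3 \<subseteq> V; S4 \<subseteq> V; leibniz_on mul br U S2 S3 S4; leibniz_on mul br W S2 S3 S4\<rbrakk>
    \<Longrightarrow> leibniz_on mul br V S2 S3 S4"
  and "\<lbrakk>S1 \<subseteq> V; S3 \<subseteq> V; S4 \<subseteq> V; leibniz_on mul br S1 U S3 S4; leibniz_on mul br S1 W S3 S4\<rbrakk>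
    \<Longrightarrow> leibniz_on mul br S1 V S3 S4"
  and "\<lbrakk>S1 \<subseteq> V; S2 \<subseteq> V; S4 \<subseteq> V; leibniz_on mul br S1 S2 U S4; leibniz_on mul br S1 S2 W S4\<rbrakk>
    \<Longrightarrow> leibniz_on mul br S1 S2 V S4"
  and "\<lbrakk>S1 \<subseteq> V; S2 \<subseteq> V; S3 \<subseteq> V; leibniz_on mul br S1 S2 S3 U; leibniz_on mul br S1 S2 S3 W\<rbrakk>
    \<Longrightarrow> leibniz_on mul br S1 S2 S3 V"
proof -
  note decompE = decomp[THEN equalityD1, THEN subsetD, unfolded mem_Collect_eq]
  note S = sub[THEN subsetD]
  show "leibniz_on mul br V S2 S3 S4"
    if S': "S2 \<subseteq> V" "S3 \<subseteq> V" "S4 \<subseteq> V"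
      and hyp: "leibniz_on mul br U S2 S3 S4" "leibniz_on mul br W S2 S3 S4"
    unfolding leibniz_on_def
  proof (intro ballI)
    fix w x y z assume x: "w \<in> V" "x \<in> S2" "y \<in> S3" "z \<in> S4"
    obtain u u' where uw: "u \<in> U" "u' \<in> W" and decx: "w = u + u'" using decompE[OF x(1)] by blast
    have "br (mul u x) y z = mul u (br x y z) + mul x (br u y z)"
      and "br (mul u' x) y z = mul u' (br x y z) + mul x (br u' y z)"
      using hyp uw x by (simp_all add: leibniz_on_def)
    with uw x S S'[THEN subsetD] show "br (mul w x) y z = mul w (br x y z) + mul x (br w y z)"
      by (simp add: decx mul_simps br_simps)
  qed
  show "leibniz_on mul br S1 V S3 S4"
    if S': "S1 \<subseteq> V" "S3 \<subseteq> V" "S4 \<subseteq> V"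
      and hyp: "leibniz_on mul br S1 U S3 S4" "leibniz_on mul br S1 W S3 S4"
    unfolding leibniz_on_def
  proof (intro ballI)
    fix w x y z assume x: "w \<in> S1" "x \<in> V" "y \<in> S3" "z \<in> S4"
    obtain u u' where uw: "u \<in> U" "u' \<in> W" and decx: "x = u + u'" using decompE[OF x(2)] by blast
    have "br (mul w u) y z = mul w (br u y z) + mul u (br w y z)"
      and "br (mul w u') y z = mul w (br u' y z) + mul u' (br w y z)"
      using hyp uw x by (simp_all add: leibniz_on_def)
    with uw x S S'[THEN subsetD] show "br (mul w x) y z = mul w (br x y z) + mul x (br w y z)"
      by (simp add: decx mul_simps br_simps)
  qed
  show "leibniz_on mul br S1 S2 V S4"
    if S': "S1 \<subseteq> V" "S2 \<subseteq> V" "S4 \<subseteq> V"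
      and hyp: "leibniz_on mul br S1 S2 U S4" "leibniz_on mul br S1 S2 W S4"
    unfolding leibniz_on_def
  proof (intro ballI)
    fix w x y z assume x: "w \<in> S1" "x \<in> S2" "y \<in> V" "z \<in> S4"
    obtain u u' where uw: "u \<in> U" "u' \<in> W" and decx: "y = u + u'" using decompE[OF x(3)] by blast
    have "br (mul w x) u z = mul w (br x u z) + mul x (br w u z)"
      and "br (mul w x) u' z = mul w (br x u' z) + mul x (br w u' z)"
      using hyp uw x by (simp_all add: leibniz_on_def)
    with uw x S S'[THEN subsetD] show "br (mul w x) y z = mul w (br x y z) + mul x (br w y z)"
      by (simp add: decx mul_simps br_simps)
  qed
  show "leibniz_on mul br S1 S2 S3 V"
    if S': "S1 \<subseteq> V" "S2 \<subseteq> V" "S3 \<subseteq> V"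
      and hyp: "leibniz_on mul br S1 S2 S3 U" "leibniz_on mul br S1 S2 S3 W"
    unfolding leibniz_on_def
  proof (intro ballI)
    fix w x y z assume x: "w \<in> S1" "x \<in> S2" "y \<in> S3" "z \<in> V"
    obtain u u' where uw: "u \<in> U" "u' \<in> W" and decx: "z = u + u'" using decompE[OF x(4)] by blast
    have "br (mul w x) y u = mul w (br x y u) + mul x (br w y u)"
      and "br (mul w x) y u' = mul w (br x y u') + mul x (br w y u')"
      using hyp uw x by (simp_all add: leibniz_on_def)
    with uw x S S'[THEN subsetD] show "br (mul w x) y z = mul w (br x y z) + mul x (br w y z)"
      by (simp add: decx mul_simps br_simps)
  qed
qed

text \<open>Only the number of \<open>W\<close>-arguments among the two factors and among the last
  two arguments matters, which leaves nine types. Exchanging \<open>U\<close> and \<open>W\<close>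
  sends \<open>(U, U, W, W)\<close> to the type with both factors in \<open>W\<close>, and fixes
  \<open>(U, W, U, W)\<close> up to the swaps; hence two lists of five with one type in
  common.\<close>

lemma leibniz_on_iff_halves:
  "leibniz_on mul br V V V V \<longleftrightarrow> leibniz_half mul br U W \<and> leibniz_half mul br W U"
proof
  assume "leibniz_on mul br V V V V"
  then show "leibniz_half mul br U W \<and> leibniz_half mul br W U"
    unfolding leibniz_half_def leibniz_on_def using sub by blast
next
  assume half: "leibniz_half mul br U W \<and> leibniz_half mul br W U"
  from half have 1:
    "leibniz_on mul br U U U U" "leibniz_on mul br U U U W" "leibniz_on mul br U U W W"
    "leibniz_on mul br U W U U" "leibniz_on mul br U W U W"
    "leibniz_on mul br W W W W" "leibniz_on mul br W W W U" "leibniz_on mul br W W U U"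
    "leibniz_on mul br W U W W"
    by (auto simp: leibniz_half_def)
  moreover from 1 have 2: "leibniz_on mul br U U W U" "leibniz_on mul br U W W U"
    "leibniz_on mul br W W U W"
    using leibniz_on_swap34 sub by blast+
  moreover from 1 2 have "leibniz_on mul br W U U U" "leibniz_on mul br W U U W"
    "leibniz_on mul br W U W U" "leibniz_on mul br U W W W"
    using leibniz_on_swap12 sub by blast+
  ultimately show "leibniz_on mul br V V V V"
    by (intro leibniz_on_decomp subset_refl sub)
qed

end

end


section \<open>Direct sums built from mutual actions\<close>

fun sum_mul :: "('a::ab_group_add \<Rightarrow> 'a \<Rightarrow> 'a) \<Rightarrow> ('b::ab_group_add \<Rightarrow> 'b \<Rightarrow> 'b) \<Rightarrow>
    ('a \<Rightarrow> 'b \<Rightarrow> 'b) \<Rightarrow> ('b \<Rightarrow> 'a \<Rightarrow> 'a) \<Rightarrow> 'a \<times> 'b \<Rightarrow> 'a \<times> 'b \<Rightarrow> 'a \<times> 'b" where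
  "sum_mul mulA mulB muA muB (x, a) (y, b) =
    (mulA x y + muB a y + muB b x, muA x b + muA y a + mulB a b)"

text \<open>The mixed terms are forced by skew symmetry: a pair from one summand acts on an element
  of the other standing in third place. An argument brought there from the middle costs a sign, one
  brought there from the front is a cyclic shift and costs none.\<close>

fun sum_br :: "('a::ab_group_add \<Rightarrow> 'a \<Rightarrow> 'a \<Rightarrow> 'a) \<Rightarrow> ('b::ab_group_add \<Rightarrow> 'b \<Rightarrow> 'b \<Rightarrow> 'b) \<Rightarrow>
    ('a \<Rightarrow> 'a \<Rightarrow> 'b \<Rightarrow> 'b) \<Rightarrow> ('b \<Rightarrow> 'b \<Rightarrow> 'a \<Rightarrow> 'a) \<Rightarrow>
    'a \<times> 'b \<Rightarrow> 'a \<times> 'b \<Rightarrow> 'a \<times> 'b \<Rightarrow> 'a \<times> 'b" where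
  "sum_br brA brB rhoA rhoB (x, a) (y, b) (z, c) =
    (brA x y z + rhoB a b z - rhoB a c y + rhoB b c x,
     rhoA x y c - rhoA x z b + rhoA y z a + brB a b c)"

text \<open>The flip of pairs is an isomorphism between the sum built from \<open>A\<close>,
  \<open>B\<close> and the one built from \<open>B\<close>, \<open>A\<close>. It carries one half of
  each identity to the other half, so each half is computed only once.\<close>

lemma sum_mul_swap:
  "sum_mul mulB mulA muB muA (prod.swap u) (prod.swap v) = prod.swap (sum_mul mulA mulB muA muB u v)"
  by (cases u; cases v) (simp add: ac_simps)

lemma sum_br_swap:
  "sum_br brB brA rhoB rhoA (prod.swap u) (prod.swap v) (prod.swap w) =
    prod.swap (sum_br brA brB rhoA rhoB u v w)"
  by (cases u; cases v; cases w) (simp add: algebra_simps)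

lemma swap_plus: "prod.swap u + prod.swap v = prod.swap (u + v)"
  by (cases u; cases v) simp

lemma swap_eq_iff: "prod.swap u = prod.swap v \<longleftrightarrow> u = v"
  by (cases u; cases v) auto

lemma assoc_half_swap:
  "assoc_half (sum_mul mulB mulA muB muA) (prod.swap ` S) (prod.swap ` T) \<longleftrightarrow>
    assoc_half (sum_mul mulA mulB muA muB) S T"
  by (simp add: assoc_half_def assoc_on_def sum_mul_swap swap_eq_iff)

lemma fund_half_swap:
  "fund_half (sum_br brB brA rhoB rhoA) (prod.swap ` S) (prod.swap ` T) \<longleftrightarrow>
    fund_half (sum_br brA brB rhoA rhoB) S T"
  by (simp only: fund_half_def fund_on_def ball_simps sum_br_swap swap_plus swap_eq_iff)

lemma leibniz_half_swap:
  "leibniz_half (sum_mul mulB mulA muB muA) (sum_br brB brA rhoB rhoA) (prod.swap ` S) (prod.swap ` T) \<longleftrightarrow>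
    leibniz_half (sum_mul mulA mulB muA muB) (sum_br brA brB rhoA rhoB) S T"
  by (simp only: leibniz_half_def leibniz_on_def ball_simps sum_br_swap sum_mul_swap swap_plus swap_eq_iff)

lemma swap_image_Times: "prod.swap ` (S \<times> T) = T \<times> S"
  by auto

lemma Times_eq_sum:
  fixes A :: "'a::ab_group_add set" and B :: "'b::ab_group_add set"
  assumes "0 \<in> A" and "0 \<in> B"
  shows "A \<times> B = {u + w |u w. u \<in> A \<times> {0} \<and> w \<in> {0} \<times> B}"
    and "A \<times> {0} \<subseteq> A \<times> B" and "{0} \<times> B \<subseteq> A \<times> B"
  using assms by force+

section \<open>Associativity of the direct sum and matched pairs of commutative associative
  algebras\<close>

locale comm_assoc_actions =
  A: comm_assoc_algebra sA A mulA + B: comm_assoc_algebra sB B mulB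
  for sA :: "'f::field_char_0 \<Rightarrow> 'a::ab_group_add \<Rightarrow> 'a" and A mulA
    and sB :: "'f \<Rightarrow> 'b::ab_group_add \<Rightarrow> 'b" and B mulB +
  fixes muA muB
  assumes muA_bilinear: "bilinear_on sA A sB B sB B muA"
    and muB_bilinear: "bilinear_on sB B sA A sA A muB"
begin

lemmas mulA_simps = bilinear_on_simps[OF A.mul_bilinear A.linear_space_axioms A.linear_space_axioms]
lemmas mulB_simps = bilinear_on_simps[OF B.mul_bilinear B.linear_space_axioms B.linear_space_axioms]
lemmas muA_simps = bilinear_on_simps[OF muA_bilinear A.linear_space_axioms B.linear_space_axioms]
lemmas muB_simps = bilinear_on_simps[OF muB_bilinear B.linear_space_axioms A.linear_space_axioms]
lemmas product_simps = mulA_simps mulB_simps muA_simps muB_simps A.carrier_simps B.carrier_simps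

lemma comm_assoc_swapped: "comm_assoc_actions sB B mulB sA A mulA muB muA"
  by unfold_locales (fact muA_bilinear muB_bilinear)+

lemma comm_bilinear_sum:
  "comm_bilinear (module_prod.scale sA sB) (A \<times> B) (sum_mul mulA mulB muA muB)"
proof -
  note scale = prod_scale_Pair[OF A.linear_space_axioms B.linear_space_axioms]
  interpret linear_space "module_prod.scale sA sB" "A \<times> B"
    by (intro linear_space_Times A.linear_space_axioms B.linear_space_axioms)
  show ?thesis
  proof
    show "bilinear_on (module_prod.scale sA sB) (A \<times> B) (module_prod.scale sA sB) (A \<times> B)
        (module_prod.scale sA sB) (A \<times> B) (sum_mul mulA mulB muA muB)"
      unfolding bilinear_on_def
      by (intro conjI ballI linear_onI)
        (auto simp: scale product_simps A.scale_right_distrib B.scale_right_distrib)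
    show "sum_mul mulA mulB muA muB u v = sum_mul mulA mulB muA muB v u"
      if "u \<in> A \<times> B" "v \<in> A \<times> B" for u v
    proof (cases u; cases v)
      fix x a y b assume [simp]: "u = (x, a)" "v = (y, b)"
      from that show ?thesis
        by (simp add: A.mul_commute[of x y] B.mul_commute[of a b] ac_simps)
    qed
  qed
qed

text \<open>The type with all arguments in \<open>A\<close> is associativity of \<open>A\<close>.
  For the type with the last argument in \<open>B\<close>, the \<open>B\<close>-component is the
  representation identity for \<open>muA\<close> and the \<open>A\<close>-component is the
  compatibility of \<open>muB\<close> with \<open>mulA\<close>, with \<open>x\<close> and
  \<open>y\<close> exchanged.\<close>

lemma assoc_half_iff:
  "assoc_half (sum_mul mulA mulB muA muB) (A \<times> {0}) ({0} \<times> B) \<longleftrightarrow>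
    comm_assoc_rep sA A mulA sB B muA \<and>
    (\<forall>b\<in>B. \<forall>x\<in>A. \<forall>y\<in>A. muB b (mulA x y) = mulA (muB b x) y + muB (muA x b) y)"
proof -
  let ?m = "sum_mul mulA mulB muA muB" and ?U = "A \<times> {0}" and ?W = "{0} \<times> B"
  have "assoc_on ?m ?U ?U ?U"
    by (auto simp: assoc_on_def product_simps A.mul_assoc)
  moreover have "?m (?m (x, 0) (y, 0)) (0, b) = ?m (x, 0) (?m (y, 0) (0, b)) \<longleftrightarrow>
      muA (mulA x y) b = muA x (muA y b) \<and> muB b (mulA y x) = mulA (muB b y) x + muB (muA y b) x"
    if "x \<in> A" "y \<in> A" "b \<in> B" for x y b
    using that by (auto simp: product_simps A.mul_commute[of x y] A.mul_commute[of x "muB b y"])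
  then have "assoc_on ?m ?U ?U ?W \<longleftrightarrow>
      (\<forall>x\<in>A. \<forall>y\<in>A. \<forall>b\<in>B. muA (mulA x y) b = muA x (muA y b)) \<and>
      (\<forall>b\<in>B. \<forall>x\<in>A. \<forall>y\<in>A. muB b (mulA x y) = mulA (muB b x) y + muB (muA x b) y)"
    unfolding assoc_on_def by (simp add: Times_insert_right) blast
  moreover have "comm_assoc_rep sA A mulA sB B muA \<longleftrightarrow>
      (\<forall>x\<in>A. \<forall>y\<in>A. \<forall>b\<in>B. muA (mulA x y) b = muA x (muA y b))"
    unfolding comm_assoc_rep_def comm_assoc_rep_axioms_def
    using A.comm_assoc_algebra_axioms B.linear_space_axioms muA_bilinear by blast
  ultimately show ?thesis by (simp add: assoc_half_def)
qed

lemma assoc_sum_iff: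
  "assoc_on (sum_mul mulA mulB muA muB) (A \<times> B) (A \<times> B) (A \<times> B) \<longleftrightarrow>
    matched_pair_comm_assoc sA A mulA sB B mulB muA muB"
proof -
  interpret S: comm_bilinear "module_prod.scale sA sB" "A \<times> B" "sum_mul mulA mulB muA muB"
    by (rule comm_bilinear_sum)
  have "assoc_half (sum_mul mulA mulB muA muB) ({0} \<times> B) (A \<times> {0}) \<longleftrightarrow>
      assoc_half (sum_mul mulB mulA muB muA) (B \<times> {0}) ({0} \<times> A)"
    using assoc_half_swap[of mulB mulA muB muA "{0} \<times> B" "A \<times> {0}"] by (simp add: swap_image_Times)
  then show ?thesis
    unfolding S.assoc_on_iff_halves[OF Times_eq_sum[OF A.carrier_simps(1) B.carrier_simps(1)]]
      assoc_half_iff comm_assoc_actions.assoc_half_iff[OF comm_assoc_swapped]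
      matched_pair_comm_assoc_def matched_pair_comm_assoc_axioms_def
    by blast
qed

end

section \<open>The fundamental identity of the direct sum and matched pairs of 3-Lie
  algebras\<close>

lemma (in three_lie_algebra) br_cycle:
  assumes "x \<in> V" "y \<in> V" "z \<in> V"
  shows "br y z x = br x y z"
  using assms br_skew12[of x y z] br_skew23[of y x z] by simp

text \<open>The actions are only assumed to be trilinear and skew: being a representation is part of
  what the fundamental identity of the sum has to be equivalent to.\<close>

locale three_lie_actions =
  A: three_lie_algebra sA A brA + B: three_lie_algebra sB B brB
  for sA :: "'f::field_char_0 \<Rightarrow> 'a::ab_group_add \<Rightarrow> 'a" and A brA
    and sB :: "'f \<Rightarrow> 'b::ab_group_add \<Rightarrow> 'b" and B brB +
  fixes rhoA rhoB
  assumes rhoA_trilinear: "trilinear_on sA A sA A sB B sB B rhoA"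
    and rhoA_skew: "\<lbrakk>x \<in> A; y \<in> A; b \<in> B\<rbrakk> \<Longrightarrow> rhoA y x b = - rhoA x y b"
    and rhoB_trilinear: "trilinear_on sB B sB B sA A sA A rhoB"
    and rhoB_skew: "\<lbrakk>a \<in> B; b \<in> B; x \<in> A\<rbrakk> \<Longrightarrow> rhoB b a x = - rhoB a b x"
begin

lemmas brA_simps = trilinear_on_simps[OF A.br_trilinear A.linear_space_axioms A.linear_space_axioms A.linear_space_axioms]
lemmas brB_simps = trilinear_on_simps[OF B.br_trilinear B.linear_space_axioms B.linear_space_axioms B.linear_space_axioms]
lemmas rhoA_simps = trilinear_on_simps[OF rhoA_trilinear A.linear_space_axioms A.linear_space_axioms B.linear_space_axioms]
lemmas rhoB_simps = trilinear_on_simps[OF rhoB_trilinear B.linear_space_axioms B.linear_space_axioms A.linear_space_axioms]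
lemmas bracket_simps = brA_simps brB_simps rhoA_simps rhoB_simps A.carrier_simps B.carrier_simps

lemma three_lie_swapped: "three_lie_actions sB B brB sA A brA rhoB rhoA"
  by unfold_locales (fact rhoA_trilinear rhoB_trilinear rhoA_skew rhoB_skew)+

lemma skew_trilinear_sum:
  "skew_trilinear (module_prod.scale sA sB) (A \<times> B) (sum_br brA brB rhoA rhoB)"
proof -
  note scale = prod_scale_Pair[OF A.linear_space_axioms B.linear_space_axioms]
  interpret linear_space "module_prod.scale sA sB" "A \<times> B"
    by (intro linear_space_Times A.linear_space_axioms B.linear_space_axioms)
  show ?thesis
  proof
    show "trilinear_on (module_prod.scale sA sB) (A \<times> B) (module_prod.scale sA sB) (A \<times> B)
        (module_prod.scale sA sB) (A \<times> B) (module_prod.scale sA sB) (A \<times> B) (sum_br brA brB rhoA rhoB)"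
      unfolding trilinear_on_def
      by (intro conjI ballI linear_onI)
        (auto simp: scale bracket_simps A.scale_right_distrib B.scale_right_distrib
          A.scale_right_diff_distrib B.scale_right_diff_distrib)
  next
    fix u v w assume S: "u \<in> A \<times> B" "v \<in> A \<times> B" "w \<in> A \<times> B"
    obtain x a y b z c where [simp]: "u = (x, a)" "v = (y, b)" "w = (z, c)"
      by (cases u; cases v; cases w)
    from S have mem: "x \<in> A" "y \<in> A" "z \<in> A" "a \<in> B" "b \<in> B" "c \<in> B" by auto
    show "sum_br brA brB rhoA rhoB v u w = - sum_br brA brB rhoA rhoB u v w"
      using mem by (simp add: A.br_skew12[of x y] B.br_skew12[of a b] rhoA_skew[of x y]
          rhoB_skew[of a b] algebra_simps)
    show "sum_br brA brB rhoA rhoB u w v = - sum_br brA brB rhoA rhoB u v w"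
      using mem by (simp add: A.br_skew23[of x y] B.br_skew23[of a b] rhoA_skew[of y z]
          rhoB_skew[of b c] algebra_simps)
  qed
qed

text \<open>By the grading, a type with one argument in \<open>B\<close> has values in
  \<open>B\<close> and gives a representation identity, and a type with two such arguments has
  values in \<open>A\<close> and gives a compatibility identity. There are two types of the first
  kind and three of the second, matching the two quadratic axioms of \<open>three_lie_rep\<close>
  and the three clauses of \<open>three_lie_compatible\<close>.\<close>

lemma fund_half_iff:
  "fund_half (sum_br brA brB rhoA rhoB) (A \<times> {0}) ({0} \<times> B) \<longleftrightarrow>
    three_lie_rep sA A brA sB B rhoA \<and> three_lie_compatible A brA B rhoA rhoB"
proof -
  let ?b = "sum_br brA brB rhoA rhoB" and ?U = "A \<times> {0}" and ?W = "{0} \<times> B"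
  have 0: "fund_on ?b ?U ?U ?U ?U ?U"
    unfolding fund_on_def by (auto simp: bracket_simps intro!: A.fundamental_identity)
  have 1: "fund_on ?b ?U ?U ?U ?U ?W \<longleftrightarrow> (\<forall>x1\<in>A. \<forall>x2\<in>A. \<forall>x3\<in>A. \<forall>x4\<in>A. \<forall>w\<in>B.
      rhoA x1 x2 (rhoA x3 x4 w) - rhoA x3 x4 (rhoA x1 x2 w) =
        rhoA (brA x1 x2 x3) x4 w - rhoA (brA x1 x2 x4) x3 w)"
  proof -
    have "?b (x1, 0) (x2, 0) (?b (x3, 0) (x4, 0) (0, w)) =
        ?b (?b (x1, 0) (x2, 0) (x3, 0)) (x4, 0) (0, w) +
        ?b (x3, 0) (?b (x1, 0) (x2, 0) (x4, 0)) (0, w) +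
        ?b (x3, 0) (x4, 0) (?b (x1, 0) (x2, 0) (0, w)) \<longleftrightarrow>
      rhoA x1 x2 (rhoA x3 x4 w) - rhoA x3 x4 (rhoA x1 x2 w) =
        rhoA (brA x1 x2 x3) x4 w - rhoA (brA x1 x2 x4) x3 w"
      if "x1 \<in> A" "x2 \<in> A" "x3 \<in> A" "x4 \<in> A" "w \<in> B" for x1 x2 x3 x4 w
      using that by (simp add: bracket_simps rhoA_skew[of "brA x1 x2 x4" x3] algebra_simps)
    then show ?thesis by (simp add: fund_on_def Times_insert_right del: sum_br.simps)
  qed
  \<comment> \<open>The outer pair is \<open>(x4, w)\<close>. By skewness, bracketing with it sends
    \<open>u\<close> to \<open>rhoA u x4 w\<close>, which turns the left side into
    \<open>rhoA (brA x1 x2 x3) x4 w\<close>.\<close>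
  have 2: "fund_on ?b ?U ?W ?U ?U ?U \<longleftrightarrow> (\<forall>x1\<in>A. \<forall>x2\<in>A. \<forall>x3\<in>A. \<forall>x4\<in>A. \<forall>w\<in>B.
      rhoA (brA x1 x2 x3) x4 w =
        rhoA x1 x2 (rhoA x3 x4 w) + rhoA x2 x3 (rhoA x1 x4 w) + rhoA x3 x1 (rhoA x2 x4 w))"
  proof -
    have "?b (x4, 0) (0, w) (?b (x1, 0) (x2, 0) (x3, 0)) =
        ?b (?b (x4, 0) (0, w) (x1, 0)) (x2, 0) (x3, 0) +
        ?b (x1, 0) (?b (x4, 0) (0, w) (x2, 0)) (x3, 0) +
        ?b (x1, 0) (x2, 0) (?b (x4, 0) (0, w) (x3, 0)) \<longleftrightarrow>
      rhoA (brA x1 x2 x3) x4 w =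
        rhoA x1 x2 (rhoA x3 x4 w) + rhoA x2 x3 (rhoA x1 x4 w) + rhoA x3 x1 (rhoA x2 x4 w)"
      if "x1 \<in> A" "x2 \<in> A" "x3 \<in> A" "x4 \<in> A" "w \<in> B" for x1 x2 x3 x4 w
      using that by (simp add: bracket_simps rhoA_skew[of "brA x1 x2 x3" x4] rhoA_skew[of x1 x4]
          rhoA_skew[of x2 x4] rhoA_skew[of x3 x4] rhoA_skew[of x1 x3] algebra_simps)
    then show ?thesis by (simp add: fund_on_def Times_insert_right del: sum_br.simps) blast
  qed
  have 3: "fund_on ?b ?W ?W ?U ?U ?U \<longleftrightarrow> (\<forall>x1\<in>A. \<forall>x2\<in>A. \<forall>x3\<in>A. \<forall>y4\<in>B. \<forall>y5\<in>B.
      rhoB y4 y5 (brA x1 x2 x3) =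
        brA (rhoB y4 y5 x1) x2 x3 + brA x1 (rhoB y4 y5 x2) x3 + brA x1 x2 (rhoB y4 y5 x3))"
  proof -
    have "?b (0, y4) (0, y5) (?b (x1, 0) (x2, 0) (x3, 0)) =
        ?b (?b (0, y4) (0, y5) (x1, 0)) (x2, 0) (x3, 0) +
        ?b (x1, 0) (?b (0, y4) (0, y5) (x2, 0)) (x3, 0) +
        ?b (x1, 0) (x2, 0) (?b (0, y4) (0, y5) (x3, 0)) \<longleftrightarrow>
      rhoB y4 y5 (brA x1 x2 x3) =
        brA (rhoB y4 y5 x1) x2 x3 + brA x1 (rhoB y4 y5 x2) x3 + brA x1 x2 (rhoB y4 y5 x3)"
      if "x1 \<in> A" "x2 \<in> A" "x3 \<in> A" "y4 \<in> B" "y5 \<in> B" for x1 x2 x3 y4 y5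
      using that by (simp add: bracket_simps)
    then show ?thesis by (simp add: fund_on_def Times_insert_right del: sum_br.simps) blast
  qed
  \<comment> \<open>Bracketing with the outer pair \<open>(x4, x5)\<close> has to act as a
    derivation on the inner bracket \<open>rhoB y2 y3 x1\<close>. Cyclic invariance of
    \<open>brA\<close> brings the pair behind the element it acts on.\<close>
  have 4: "fund_on ?b ?U ?U ?U ?W ?W \<longleftrightarrow> (\<forall>x1\<in>A. \<forall>x4\<in>A. \<forall>x5\<in>A. \<forall>y2\<in>B. \<forall>y3\<in>B.
      brA (rhoB y2 y3 x1) x4 x5 =
        rhoB y2 y3 (brA x1 x4 x5) + rhoB (rhoA x4 x5 y2) y3 x1 + rhoB y2 (rhoA x4 x5 y3) x1)"
  proof -
    have "?b (x4, 0) (x5, 0) (?b (x1, 0) (0, y2) (0, y3)) =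
        ?b (?b (x4, 0) (x5, 0) (x1, 0)) (0, y2) (0, y3) +
        ?b (x1, 0) (?b (x4, 0) (x5, 0) (0, y2)) (0, y3) +
        ?b (x1, 0) (0, y2) (?b (x4, 0) (x5, 0) (0, y3)) \<longleftrightarrow>
      brA (rhoB y2 y3 x1) x4 x5 =
        rhoB y2 y3 (brA x1 x4 x5) + rhoB (rhoA x4 x5 y2) y3 x1 + rhoB y2 (rhoA x4 x5 y3) x1"
      if "x1 \<in> A" "x4 \<in> A" "x5 \<in> A" "y2 \<in> B" "y3 \<in> B" for x1 x4 x5 y2 y3
      using that by (simp add: bracket_simps A.br_cycle[of x1 x4 x5] A.br_cycle[of "rhoB y2 y3 x1" x4 x5])
    then show ?thesis by (simp add: fund_on_def Times_insert_right del: sum_br.simps) blast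
  qed
  \<comment> \<open>Here the outer pair is \<open>(x4, y5)\<close>, one element from each summand,
    and the inner bracket is \<open>rhoA x1 x2 y3\<close>.\<close>
  have 5: "fund_on ?b ?U ?W ?U ?U ?W \<longleftrightarrow> (\<forall>x1\<in>A. \<forall>x2\<in>A. \<forall>x4\<in>A. \<forall>y3\<in>B. \<forall>y5\<in>B.
      - rhoB (rhoA x1 x2 y3) y5 x4 =
        - rhoB (rhoA x1 x4 y5) y3 x2 + rhoB (rhoA x2 x4 y5) y3 x1 - brA x1 x2 (rhoB y3 y5 x4))"
  proof -
    have "?b (x4, 0) (0, y5) (?b (x1, 0) (x2, 0) (0, y3)) =
        ?b (?b (x4, 0) (0, y5) (x1, 0)) (x2, 0) (0, y3) +
        ?b (x1, 0) (?b (x4, 0) (0, y5) (x2, 0)) (0, y3) +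
        ?b (x1, 0) (x2, 0) (?b (x4, 0) (0, y5) (0, y3)) \<longleftrightarrow>
      - rhoB (rhoA x1 x2 y3) y5 x4 =
        - rhoB (rhoA x1 x4 y5) y3 x2 + rhoB (rhoA x2 x4 y5) y3 x1 - brA x1 x2 (rhoB y3 y5 x4)"
      if "x1 \<in> A" "x2 \<in> A" "x4 \<in> A" "y3 \<in> B" "y5 \<in> B" for x1 x2 x4 y3 y5
      using that by (simp add: bracket_simps rhoB_skew[of "rhoA x1 x2 y3" y5] rhoA_skew[of x1 x4]
          rhoA_skew[of x2 x4] rhoB_skew[of y3 y5])
    then show ?thesis by (simp add: fund_on_def Times_insert_right del: sum_br.simps) blast
  qed
  have "three_lie_rep sA A brA sB B rhoA \<longleftrightarrow> fund_on ?b ?U ?U ?U ?U ?W \<and> fund_on ?b ?U ?W ?U ?U ?U"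
    unfolding 1 2 three_lie_rep_def three_lie_rep_axioms_def
    using A.three_lie_algebra_axioms B.linear_space_axioms rhoA_trilinear rhoA_skew by blast
  moreover have "three_lie_compatible A brA B rhoA rhoB \<longleftrightarrow>
      fund_on ?b ?W ?W ?U ?U ?U \<and> fund_on ?b ?U ?W ?U ?U ?W \<and> fund_on ?b ?U ?U ?U ?W ?W"
    unfolding 3 4 5 three_lie_compatible_def ..
  ultimately show ?thesis
    using 0 unfolding fund_half_def by blast
qed

lemma fund_sum_iff:
  "fund_on (sum_br brA brB rhoA rhoB) (A \<times> B) (A \<times> B) (A \<times> B) (A \<times> B) (A \<times> B) \<longleftrightarrow>
    matched_pair_three_lie sA A brA sB B brB rhoA rhoB"
proof -
  interpret S: skew_trilinear "module_prod.scale sA sB" "A \<times> B" "sum_br brA brB rhoA rhoB"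
    by (rule skew_trilinear_sum)
  have "fund_half (sum_br brA brB rhoA rhoB) ({0} \<times> B) (A \<times> {0}) \<longleftrightarrow>
      fund_half (sum_br brB brA rhoB rhoA) (B \<times> {0}) ({0} \<times> A)"
    using fund_half_swap[of brB brA rhoB rhoA "{0} \<times> B" "A \<times> {0}"] by (simp add: swap_image_Times)
  then show ?thesis
    unfolding S.fund_on_iff_halves[OF Times_eq_sum[OF A.carrier_simps(1) B.carrier_simps(1)]]
      fund_half_iff three_lie_actions.fund_half_iff[OF three_lie_swapped]
      matched_pair_three_lie_def matched_pair_three_lie_axioms_def
    by blast
qed

end

section \<open>The Leibniz rule of the direct sum and matched pairs of Poisson 3-Lie
  algebras\<close>

definition mixed_leibniz ::
  "'a::ab_group_add set \<Rightarrow> ('a \<Rightarrow> 'a \<Rightarrow> 'a) \<Rightarrow> ('a \<Rightarrow> 'a \<Rightarrow> 'a \<Rightarrow> 'a) \<Rightarrow>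
    'b::ab_group_add set \<Rightarrow> ('b \<Rightarrow> 'b \<Rightarrow> 'b) \<Rightarrow>
    ('a \<Rightarrow> 'b \<Rightarrow> 'b) \<Rightarrow> ('a \<Rightarrow> 'a \<Rightarrow> 'b \<Rightarrow> 'b) \<Rightarrow> ('b \<Rightarrow> 'a \<Rightarrow> 'a) \<Rightarrow> ('b \<Rightarrow> 'b \<Rightarrow> 'a \<Rightarrow> 'a) \<Rightarrow> bool" where
  "mixed_leibniz A mulA brA B mulB muA rhoA muB rhoB \<longleftrightarrow>
    (\<forall>x\<in>A. \<forall>y\<in>A. \<forall>z\<in>A. \<forall>b\<in>B.
      rhoA (mulA x y) z b = muA x (rhoA y z b) + muA y (rhoA x z b) \<and>
      muB (rhoA x y b) z + muB (rhoA z y b) x = 0 \<and>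
      rhoA x y (muA z b) = muA (brA x y z) b + muA z (rhoA x y b) \<and>
      brA (muB b x) y z = muB (rhoA y z b) x + muB b (brA x y z)) \<and>
    (\<forall>x\<in>A. \<forall>y\<in>A. \<forall>a\<in>B. \<forall>b\<in>B.
      rhoB a b (mulA x y) = mulA x (rhoB a b y) + mulA y (rhoB a b x) \<and>
      rhoB (muA x a) b y = mulA x (rhoB a b y) \<and>
      rhoA (muB a x) y b = mulB a (rhoA x y b))"

locale poisson_actions =
  comm_assoc_actions sA A mulA sB B mulB muA muB + three_lie_actions sA A brA sB B brB rhoA rhoB +
  A: poisson_three_lie_algebra sA A mulA brA + B: poisson_three_lie_algebra sB B mulB brB
  for sA :: "'f::field_char_0 \<Rightarrow> 'a::ab_group_add \<Rightarrow> 'a" and A mulA brA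
    and sB :: "'f \<Rightarrow> 'b::ab_group_add \<Rightarrow> 'b" and B mulB brB muA muB rhoA rhoB
begin

lemmas poisson_simps = product_simps bracket_simps

lemma poisson_swapped: "poisson_actions sB B mulB brB sA A mulA brA muB muA rhoB rhoA"
  by (intro poisson_actions.intro comm_assoc_swapped three_lie_swapped
      A.poisson_three_lie_algebra_axioms B.poisson_three_lie_algebra_axioms)

lemma comm_bilinear_skew_trilinear_sum:
  "comm_bilinear_skew_trilinear (module_prod.scale sA sB) (A \<times> B)
    (sum_mul mulA mulB muA muB) (sum_br brA brB rhoA rhoB)"
  by (intro comm_bilinear_skew_trilinear.intro comm_bilinear_sum skew_trilinear_sum)

text \<open>The first block of \<open>mixed_leibniz\<close> collects the types with one argument in
  \<open>B\<close>: two identities from the \<open>B\<close>-argument inside the bracket, two from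
  it as a factor. In the second block, with two arguments in \<open>B\<close>, the first identity
  has both inside the bracket and the other two have one of them as a factor.\<close>

lemma leibniz_half_iff:
  "leibniz_half (sum_mul mulA mulB muA muB) (sum_br brA brB rhoA rhoB) (A \<times> {0}) ({0} \<times> B) \<longleftrightarrow>
    mixed_leibniz A mulA brA B mulB muA rhoA muB rhoB"
proof -
  let ?m = "sum_mul mulA mulB muA muB" and ?b = "sum_br brA brB rhoA rhoB"
    and ?U = "A \<times> {0}" and ?W = "{0} \<times> B"
  note defs = leibniz_on_def Times_insert_right
  have 0: "leibniz_on ?m ?b ?U ?U ?U ?U"
    unfolding leibniz_on_def by (auto simp: poisson_simps intro!: A.leibniz)
  \<comment> \<open>The left side lies in \<open>B\<close>, whereas multiplying an element of
    \<open>A\<close> with one of \<open>B\<close> on the right also produces an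
    \<open>A\<close>-component. That component has to vanish, which is the origin of the identity
    with right side 0.\<close>
  have "?b (?m (x, 0) (y, 0)) (z, 0) (0, b) =
      ?m (x, 0) (?b (y, 0) (z, 0) (0, b)) + ?m (y, 0) (?b (x, 0) (z, 0) (0, b)) \<longleftrightarrow>
    rhoA (mulA x y) z b = muA x (rhoA y z b) + muA y (rhoA x z b) \<and>
    muB (rhoA y z b) x + muB (rhoA x z b) y = 0"
    if "x \<in> A" "y \<in> A" "z \<in> A" "b \<in> B" for x y z b
    using that by (auto simp: poisson_simps)
  then have 1: "leibniz_on ?m ?b ?U ?U ?U ?W \<longleftrightarrow> (\<forall>x\<in>A. \<forall>y\<in>A. \<forall>z\<in>A. \<forall>b\<in>B.
      rhoA (mulA x y) z b = muA x (rhoA y z b) + muA y (rhoA x z b) \<and>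
      muB (rhoA y z b) x + muB (rhoA x z b) y = 0)"
    by (simp add: defs del: sum_mul.simps sum_br.simps)
  \<comment> \<open>The only mixed type without a second component: a bracket with two arguments
    from \<open>B\<close> returns to \<open>A\<close>, where the product stays.\<close>
  have "?b (?m (x, 0) (y, 0)) (0, a) (0, b) =
      ?m (x, 0) (?b (y, 0) (0, a) (0, b)) + ?m (y, 0) (?b (x, 0) (0, a) (0, b)) \<longleftrightarrow>
    rhoB a b (mulA x y) = mulA x (rhoB a b y) + mulA y (rhoB a b x)"
    if "x \<in> A" "y \<in> A" "a \<in> B" "b \<in> B" for x y a b
    using that by (auto simp: poisson_simps)
  then have 2: "leibniz_on ?m ?b ?U ?U ?W ?W \<longleftrightarrow> (\<forall>x\<in>A. \<forall>y\<in>A. \<forall>a\<in>B. \<forall>b\<in>B.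
      rhoB a b (mulA x y) = mulA x (rhoB a b y) + mulA y (rhoB a b x))"
    by (simp add: defs del: sum_mul.simps sum_br.simps)
  have "?b (?m (x, 0) (0, b)) (y, 0) (z, 0) =
      ?m (x, 0) (?b (0, b) (y, 0) (z, 0)) + ?m (0, b) (?b (x, 0) (y, 0) (z, 0)) \<longleftrightarrow>
    rhoA y z (muA x b) = muA (brA y z x) b + muA x (rhoA y z b) \<and>
    brA (muB b x) y z = muB (rhoA y z b) x + muB b (brA x y z)"
    if "x \<in> A" "y \<in> A" "z \<in> A" "b \<in> B" for x y z b
    using that by (auto simp: poisson_simps A.br_cycle[of x y z] ac_simps)
  then have 3: "leibniz_on ?m ?b ?U ?W ?U ?U \<longleftrightarrow> (\<forall>x\<in>A. \<forall>b\<in>B. \<forall>y\<in>A. \<forall>z\<in>A.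
      rhoA y z (muA x b) = muA (brA y z x) b + muA x (rhoA y z b) \<and>
      brA (muB b x) y z = muB (rhoA y z b) x + muB b (brA x y z))"
    by (simp add: defs del: sum_mul.simps sum_br.simps)
  \<comment> \<open>The two components of the product of \<open>x\<close> and \<open>a\<close> are
    bracketed into different summands, and the two terms on the right lie in different summands as
    well. The two identities obtained are interchanged when the summands are exchanged.\<close>
  have "?b (?m (x, 0) (0, a)) (y, 0) (0, b) =
      ?m (x, 0) (?b (0, a) (y, 0) (0, b)) + ?m (0, a) (?b (x, 0) (y, 0) (0, b)) \<longleftrightarrow>
    rhoB (muA x a) b y = mulA x (rhoB a b y) \<and> rhoA (muB a x) y b = mulB a (rhoA x y b)"
    if "x \<in> A" "y \<in> A" "a \<in> B" "b \<in> B" for x y a b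
    using that by (auto simp: poisson_simps)
  then have 4: "leibniz_on ?m ?b ?U ?W ?U ?W \<longleftrightarrow> (\<forall>x\<in>A. \<forall>a\<in>B. \<forall>y\<in>A. \<forall>b\<in>B.
      rhoB (muA x a) b y = mulA x (rhoB a b y) \<and> rhoA (muB a x) y b = mulB a (rhoA x y b))"
    by (simp add: defs del: sum_mul.simps sum_br.simps)
  show ?thesis
    unfolding leibniz_half_def 1 2 3 4 mixed_leibniz_def using 0 by auto
qed

theorem poisson_sum_iff:
  "poisson_three_lie_algebra (module_prod.scale sA sB) (A \<times> B)
      (sum_mul mulA mulB muA muB) (sum_br brA brB rhoA rhoB) \<longleftrightarrow>
    matched_pair_poisson_three_lie sA A mulA brA sB B mulB brB rhoA muA rhoB muB"
proof -
  let ?m = "sum_mul mulA mulB muA muB" and ?b = "sum_br brA brB rhoA rhoB"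
  interpret S: comm_bilinear_skew_trilinear "module_prod.scale sA sB" "A \<times> B" ?m ?b
    by (rule comm_bilinear_skew_trilinear_sum)
  have "leibniz_half ?m ?b ({0} \<times> B) (A \<times> {0}) \<longleftrightarrow> mixed_leibniz B mulB brB A mulA muB rhoB muA rhoA"
    using leibniz_half_swap[of mulB mulA muB muA brB brA rhoB rhoA "{0} \<times> B" "A \<times> {0}"]
      poisson_actions.leibniz_half_iff[OF poisson_swapped] by (simp add: swap_image_Times)
  then have lz: "leibniz_on ?m ?b (A \<times> B) (A \<times> B) (A \<times> B) (A \<times> B) \<longleftrightarrow>
      mixed_leibniz A mulA brA B mulB muA rhoA muB rhoB \<and>
      mixed_leibniz B mulB brB A mulA muB rhoB muA rhoA"
    using S.leibniz_on_iff_halves[OF Times_eq_sum[OF A.carrier_simps(1) B.carrier_simps(1)]]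
      leibniz_half_iff by blast
  have rep_iff:
    "poisson_three_lie_rep sA A mulA brA sB B rhoA muA \<longleftrightarrow>
      comm_assoc_rep sA A mulA sB B muA \<and> three_lie_rep sA A brA sB B rhoA \<and>
      poisson_three_lie_rep_axioms A mulA brA B rhoA muA"
    "poisson_three_lie_rep sB B mulB brB sA A rhoB muB \<longleftrightarrow>
      comm_assoc_rep sB B mulB sA A muB \<and> three_lie_rep sB B brB sA A rhoB \<and>
      poisson_three_lie_rep_axioms B mulB brB A rhoB muB"
    unfolding poisson_three_lie_rep_def
    using A.poisson_three_lie_algebra_axioms B.poisson_three_lie_algebra_axioms by blast+
  \<comment> \<open>Each half contributes seven identities; \<open>rhoB_muA\<close> and
    \<open>rhoA_muB\<close> occur in both. The twelve distinct ones are the two Poisson axioms of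
    each representation and the eight conditions of the matched pair.\<close>
  have mixed_iff: "mixed_leibniz A mulA brA B mulB muA rhoA muB rhoB \<and>
      mixed_leibniz B mulB brB A mulA muB rhoB muA rhoA \<longleftrightarrow>
    poisson_three_lie_rep_axioms A mulA brA B rhoA muA \<and>
    poisson_three_lie_rep_axioms B mulB brB A rhoB muB \<and>
    matched_pair_poisson_three_lie_axioms A mulA brA B mulB brB rhoA muA rhoB muB"
    (is "?l1 \<and> ?l2 \<longleftrightarrow> ?r")
  proof (intro iffI conjI)
    assume l: "?l1 \<and> ?l2"
    note l1 = l[THEN conjunct1, unfolded mixed_leibniz_def, rule_format]
      and l2 = l[THEN conjunct2, unfolded mixed_leibniz_def, rule_format]
    show "poisson_three_lie_rep_axioms A mulA brA B rhoA muA"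
      by (rule poisson_three_lie_rep_axioms.intro) (simp_all only: l1)
    show "poisson_three_lie_rep_axioms B mulB brB A rhoB muB"
      by (rule poisson_three_lie_rep_axioms.intro) (simp_all only: l2)
    show "matched_pair_poisson_three_lie_axioms A mulA brA B mulB brB rhoA muA rhoB muB"
      by (rule matched_pair_poisson_three_lie_axioms.intro) (simp_all only: l1 l2)
  next
    assume r: ?r
    note r1 = r[THEN conjunct1, unfolded poisson_three_lie_rep_axioms_def]
      and r2 = r[THEN conjunct2, THEN conjunct1, unfolded poisson_three_lie_rep_axioms_def]
      and r3 = r[THEN conjunct2, THEN conjunct2, unfolded matched_pair_poisson_three_lie_axioms_def]
    show ?l1 unfolding mixed_leibniz_def using r1 r3 by simp
    show ?l2 unfolding mixed_leibniz_def using r2 r3 by simp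
  qed
  show ?thesis
    unfolding S.poisson_three_lie_iff_on assoc_sum_iff fund_sum_iff lz mixed_iff
      matched_pair_poisson_three_lie_def rep_iff
      matched_pair_comm_assoc_def matched_pair_three_lie_def
    by blast
qed

end


section \<open>The double of a space and its dual\<close>

lemma dual_scale_apply: "dual_scale c \<xi> x = c * \<xi> x"
  by (simp add: dual_scale_def)

lemma (in linear_space) linear_on_sum:
  assumes "linear_on s V t W f" and "finite I" and "\<And>i. i \<in> I \<Longrightarrow> u i \<in> V"
  shows "f (\<Sum>i\<in>I. u i) = (\<Sum>i\<in>I. f (u i))"
  using assms(2,3)
proof (induction I rule: finite_induct)
  case empty
  show ?case using linear_on_zero_minus(1)[OF assms(1) linear_space_axioms] by simp
next
  case (insert i I)
  then show ?case
    using linear_on_simps(2)[OF assms(1), of "u i" "\<Sum>i\<in>I. u i"]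
    by (simp add: subspace_sum[OF subspace_carrier])
qed

text \<open>The assumption on the dual is supplied by the algebra given on the dual, whose locale
  contains it.\<close>

locale finite_dimensional_linear_space = finite_dimensional_vector_space s Basis
  for s :: "'f::field_char_0 \<Rightarrow> 'a::ab_group_add \<Rightarrow> 'a" and Basis +
  assumes dual_linear_space: "linear_space dual_scale (dual_space s)"
begin

sublocale dual: linear_space dual_scale "dual_space s"
  by (rule dual_linear_space)

section \<open>The dual basis and transposes of operators on the dual\<close>

lemma dual_simps:
  assumes "\<xi> \<in> dual_space s"
  shows "\<xi> (x + y) = \<xi> x + \<xi> y" "\<xi> (x - y) = \<xi> x - \<xi> y" "\<xi> (- x) = - \<xi> x" "\<xi> 0 = 0"
    "\<xi> (s c x) = c * \<xi> x"
proof -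
  interpret Vector_Spaces.linear s "(*)" \<xi> using assms by (simp add: dual_space_def)
  show "\<xi> (x + y) = \<xi> x + \<xi> y" "\<xi> (x - y) = \<xi> x - \<xi> y" "\<xi> (- x) = - \<xi> x" "\<xi> 0 = 0"
    "\<xi> (s c x) = c * \<xi> x"
    by (fact add diff neg zero scale)+
qed

lemma dual_sum:
  assumes "\<xi> \<in> dual_space s"
  shows "\<xi> (sum g I) = (\<Sum>i\<in>I. \<xi> (g i))"
proof -
  interpret Vector_Spaces.linear s "(*)" \<xi> using assms by (simp add: dual_space_def)
  show ?thesis by (fact sum)
qed

lemma dual_spaceI:
  assumes "\<And>x y. \<xi> (x + y) = \<xi> x + \<xi> y" and "\<And>c x. \<xi> (s c x) = c * \<xi> x"
  shows "\<xi> \<in> dual_space s"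
proof -
  have "vector_space ((*) :: 'f \<Rightarrow> 'f \<Rightarrow> 'f)"
    by unfold_locales (simp_all add: algebra_simps)
  with assms show ?thesis
    by (simp add: dual_space_def Vector_Spaces.linear_iff vector_space_axioms)
qed

text \<open>For \<open>b\<close> in \<open>Basis\<close> these coordinate functions are the members
  of the dual basis.\<close>

lemma coordinate_in_dual: "(\<lambda>v. representation Basis v b) \<in> dual_space s"
  by (rule dual_spaceI)
    (simp_all add: representation_add representation_scale independent_Basis span_Basis)

lemma coordinate_expansion: "(\<Sum>b\<in>Basis. s (representation Basis v b) b) = v"
  by (rule sum_representation_eq) (simp_all add: independent_Basis span_Basis finite_Basis)

lemma dual_separates:
  assumes "\<And>\<zeta>. \<zeta> \<in> dual_space s \<Longrightarrow> \<zeta> v = \<zeta> w"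
  shows "v = w"
proof -
  have rep: "representation Basis v b = representation Basis w b" for b
    by (rule assms[OF coordinate_in_dual])
  have "v = (\<Sum>b\<in>Basis. s (representation Basis v b) b)"
    by (rule coordinate_expansion[symmetric])
  also have "\<dots> = (\<Sum>b\<in>Basis. s (representation Basis w b) b)"
    by (simp only: rep)
  also have "\<dots> = w"
    by (rule coordinate_expansion)
  finally show ?thesis .
qed

lemma dual_expansion:
  assumes "\<zeta> \<in> dual_space s"
  shows "\<zeta> = (\<Sum>b\<in>Basis. dual_scale (\<zeta> b) (\<lambda>v. representation Basis v b))"
proof
  fix v
  have sum: "(\<Sum>b\<in>B. dual_scale (\<zeta> b) (\<lambda>v. representation Basis v b)) v =
      (\<Sum>b\<in>B. representation Basis v b * \<zeta> b)" for B
    by (induction B rule: infinite_finite_induct) (simp_all add: dual_scale_apply mult.commute)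
  have "\<zeta> v = \<zeta> (\<Sum>b\<in>Basis. s (representation Basis v b) b)"
    by (simp only: coordinate_expansion)
  also have "\<dots> = (\<Sum>b\<in>Basis. representation Basis v b * \<zeta> b)"
    by (simp only: dual_sum[OF assms] dual_simps(5)[OF assms])
  finally show "\<zeta> v = (\<Sum>b\<in>Basis. dual_scale (\<zeta> b) (\<lambda>v. representation Basis v b)) v"
    by (simp only: sum)
qed

text \<open>Existence: a vector with the required value on the dual basis has it on every
  functional, since \<open>g\<close> is linear and functionals expand in that basis. Uniqueness:
  functionals separate vectors. Together they make the description in \<open>codual_op\<close>
  proper.\<close>

lemma codual_op_eq:
  assumes g: "linear_on dual_scale (dual_space s) dual_scale (dual_space s) g"
    and \<zeta>: "\<zeta> \<in> dual_space s"
  shows "\<zeta> (codual_op s g x) = - g \<zeta> x"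
proof -
  let ?\<delta> = "\<lambda>b v. representation Basis v b"
  \<comment> \<open>The only possible choice: the coordinate of \<open>v\<close> at \<open>b\<close>
    is its value under \<open>?\<delta> b\<close>, which is prescribed to be
    \<open>- g (?\<delta> b) x\<close>.\<close>
  define v where "v = - (\<Sum>b\<in>Basis. s (g (?\<delta> b) x) b)"
  have *: "\<zeta> v = - g \<zeta> x" if \<zeta>: "\<zeta> \<in> dual_space s" for \<zeta>
  proof -
    have "g \<zeta> = g (\<Sum>b\<in>Basis. dual_scale (\<zeta> b) (?\<delta> b))"
      using dual_expansion[OF \<zeta>] by (rule arg_cong)
    also have "\<dots> = (\<Sum>b\<in>Basis. g (dual_scale (\<zeta> b) (?\<delta> b)))"
      by (rule dual.linear_on_sum[OF g finite_Basis])
        (intro dual.carrier_simps coordinate_in_dual)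
    also have "\<dots> = (\<Sum>b\<in>Basis. dual_scale (\<zeta> b) (g (?\<delta> b)))"
      by (simp add: linear_on_simps(3)[OF g coordinate_in_dual])
    finally have 1: "g \<zeta> = \<dots>" .
    have "(\<Sum>b\<in>B. dual_scale (\<zeta> b) (g (?\<delta> b))) x = (\<Sum>b\<in>B. \<zeta> b * g (?\<delta> b) x)" for B
      by (induction B rule: infinite_finite_induct) (simp_all add: dual_scale_apply)
    then have "g \<zeta> x = (\<Sum>b\<in>Basis. \<zeta> b * g (?\<delta> b) x)"
      by (simp add: 1)
    then show ?thesis
      by (simp add: v_def dual_simps[OF \<zeta>] dual_sum[OF \<zeta>] mult.commute)
  qed
  have "\<forall>\<zeta>\<in>dual_space s. \<zeta> (codual_op s g x) = - g \<zeta> x"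
    unfolding codual_op_def
  proof (rule theI[where a = v])
    show "\<forall>\<zeta>\<in>dual_space s. \<zeta> v = - g \<zeta> x" using * by blast
    show "w = v" if "\<forall>\<zeta>\<in>dual_space s. \<zeta> w = - g \<zeta> x" for w
      using that * by (intro dual_separates) simp
  qed
  with \<zeta> show ?thesis by blast
qed

end

section \<open>The coadjoint actions and the double as a direct sum\<close>

locale poisson_double = finite_dimensional_vector_space s Basis +
  A: poisson_three_lie_algebra s UNIV mul br +
  D: poisson_three_lie_algebra dual_scale "dual_space s" muld brd
  for s :: "'f::field_char_0 \<Rightarrow> 'a::ab_group_add \<Rightarrow> 'a" and Basis mul br muld brd
begin

sublocale finite_dimensional_linear_space s Basis
  by unfold_locales

lemma coad_star_eq:
  assumes "\<xi> \<in> dual_space s" "\<eta> \<in> dual_space s" "\<zeta> \<in> dual_space s"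
  shows "\<zeta> (coad_star s brd \<xi> \<eta> x) = - brd \<xi> \<eta> \<zeta> x"
  unfolding coad_star_def using D.br_trilinear assms
  by (intro codual_op_eq) (simp_all add: trilinear_on_def)

lemma coL_star_eq:
  assumes "\<xi> \<in> dual_space s" "\<eta> \<in> dual_space s"
  shows "\<eta> (coL_star s muld \<xi> x) = - muld \<xi> \<eta> x"
  unfolding coL_star_def using D.mul_bilinear assms
  by (intro codual_op_eq) (simp_all add: bilinear_on_def)

lemma ad_star_apply: "ad_star br x y \<xi> v = - \<xi> (br x y v)"
  by (simp add: ad_star_def dual_op_def)

lemma L_star_apply: "L_star mul x \<xi> v = - \<xi> (mul x v)"
  by (simp add: L_star_def dual_op_def)

lemmas dual_br_simps =
  trilinear_on_simps[OF D.br_trilinear D.linear_space_axioms D.linear_space_axioms D.linear_space_axioms]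
lemmas dual_mul_simps =
  bilinear_on_simps[OF D.mul_bilinear D.linear_space_axioms D.linear_space_axioms]
lemmas space_br_simps =
  trilinear_on_simps[OF A.br_trilinear A.linear_space_axioms A.linear_space_axioms A.linear_space_axioms,
    simplified]
lemmas space_mul_simps =
  bilinear_on_simps[OF A.mul_bilinear A.linear_space_axioms A.linear_space_axioms, simplified]

text \<open>The dual operator carries a minus sign, so \<open>- L_star\<close> is the plain
  transpose of multiplication. This is the sign compatible with products: a product of two operators
  \<open>L_star\<close> is minus the \<open>L_star\<close> of the product.\<close>

sublocale poisson_actions s UNIV mul br dual_scale "dual_space s" muld brd
  "\<lambda>x \<xi>. - L_star mul x \<xi>" "\<lambda>\<xi> x. - coL_star s muld \<xi> x" "ad_star br" "coad_star s brd"
proof unfold_locales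
  show "bilinear_on s UNIV dual_scale (dual_space s) dual_scale (dual_space s) (\<lambda>x \<xi>. - L_star mul x \<xi>)"
    unfolding bilinear_on_def
    by (intro conjI ballI linear_onI dual_spaceI ext)
      (simp_all add: L_star_apply dual_scale_apply space_mul_simps dual_simps)
  \<comment> \<open>The values are vectors known only through their pairings, so linearity is tested
    against an arbitrary functional.\<close>
  show "bilinear_on dual_scale (dual_space s) s UNIV s UNIV (\<lambda>\<xi> x. - coL_star s muld \<xi> x)"
    unfolding bilinear_on_def
    by (intro conjI ballI linear_onI UNIV_I dual_separates)
      (simp_all add: coL_star_eq dual_mul_simps dual_simps D.carrier_simps dual_scale_apply)
  show "trilinear_on s UNIV s UNIV dual_scale (dual_space s) dual_scale (dual_space s) (ad_star br)"
    unfolding trilinear_on_def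
    by (intro conjI ballI linear_onI dual_spaceI ext)
      (simp_all add: ad_star_apply dual_scale_apply space_br_simps dual_simps)
  show "trilinear_on dual_scale (dual_space s) dual_scale (dual_space s) s UNIV s UNIV (coad_star s brd)"
    unfolding trilinear_on_def
    by (intro conjI ballI linear_onI UNIV_I dual_separates)
      (simp_all add: coad_star_eq dual_br_simps dual_simps D.carrier_simps dual_scale_apply)
  show "ad_star br y x \<xi> = - ad_star br x y \<xi>" if "\<xi> \<in> dual_space s" for x y \<xi>
    using that by (intro ext) (simp add: ad_star_apply A.br_skew12[of x y] dual_simps)
  show "coad_star s brd \<eta> \<xi> x = - coad_star s brd \<xi> \<eta> x"
    if "\<xi> \<in> dual_space s" "\<eta> \<in> dual_space s" for \<xi> \<eta> x
    using that
    by (intro dual_separates) (simp add: coad_star_eq dual_simps D.br_skew12[of \<xi> \<eta>])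
qed

lemma double_mul_eq:
  "double_mul s mul muld = sum_mul mul muld (\<lambda>x \<xi>. - L_star mul x \<xi>) (\<lambda>\<xi> x. - coL_star s muld \<xi> x)"
  by (intro ext) (auto simp: algebra_simps)

lemma double_br_eq: "double_br s br brd = sum_br br brd (ad_star br) (coad_star s brd)"
  by (intro ext) auto

lemma proj_along_dual: "proj_along (UNIV \<times> {0}) ({0} \<times> dual_space s) (0, \<xi>) = 0"
  if "\<xi> \<in> dual_space s" for \<xi>
  unfolding proj_along_def using that by (intro the_equality) (auto simp: zero_prod_def)

lemma proj_along_space: "proj_along ({0} \<times> dual_space s) (UNIV \<times> {0}) (x, 0) = 0"
  unfolding proj_along_def by (intro the_equality) (auto simp: zero_prod_def D.carrier_simps)

section \<open>The form, the two summands and the projections of the double\<close>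

lemma manin_axioms:
  "manin_triple_axioms (module_prod.scale s dual_scale) (UNIV \<times> dual_space s)
    (double_mul s mul muld) (double_br s br brd) double_form (UNIV \<times> {0}) ({0} \<times> dual_space s)"
proof -
  note scale = prod_scale_Pair[OF A.linear_space_axioms D.linear_space_axioms]
  interpret S: comm_bilinear_skew_trilinear "module_prod.scale s dual_scale" "UNIV \<times> dual_space s"
    "double_mul s mul muld" "double_br s br brd"
    unfolding double_mul_eq double_br_eq by (rule comm_bilinear_skew_trilinear_sum)
  interpret P: vector_space_prod s "dual_scale :: 'f \<Rightarrow> ('a \<Rightarrow> 'f) \<Rightarrow> _" ..
  show ?thesis
  proof
    show "bilinear_on (module_prod.scale s dual_scale) (UNIV \<times> dual_space s)
        (module_prod.scale s dual_scale) (UNIV \<times> dual_space s) (*) UNIV double_form"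
      unfolding bilinear_on_def
      by (intro conjI ballI linear_onI UNIV_I)
        (auto simp: scale dual_simps dual_scale_apply algebra_simps)
    show "double_form u v = double_form v u" for u v :: "'a \<times> ('a \<Rightarrow> 'f)"
      by (cases u; cases v) simp
    show "u = 0" if u: "u \<in> UNIV \<times> dual_space s"
      and *: "\<And>v. v \<in> UNIV \<times> dual_space s \<Longrightarrow> double_form u v = 0" for u
    proof (cases u)
      case [simp]: (Pair x \<xi>)
      \<comment> \<open>Pairing with elements of the dual detects the component \<open>x\<close>,
        pairing with vectors detects \<open>\<xi>\<close>. The zero is written as
        \<open>\<eta> 0\<close> to fit \<open>dual_separates\<close>.\<close>
      have "\<eta> x = \<eta> 0" if "\<eta> \<in> dual_space s" for \<eta>
        using *[of "(0, \<eta>)"] u that by (simp add: dual_simps)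
      then have "x = 0" by (rule dual_separates)
      moreover have "\<xi> y = 0" for y
        using *[of "(y, 0)"] by (simp add: D.carrier_simps)
      ultimately show ?thesis by (simp add: zero_prod_def fun_eq_iff)
    qed
    \<comment> \<open>Unfolded, the left side is the sum of \<open>\<zeta> (mul x y)\<close>,
      \<open>\<eta> (mul x z)\<close>, \<open>\<xi> (mul y z)\<close>,
      \<open>muld \<xi> \<eta> z\<close>, \<open>muld \<xi> \<zeta> y\<close> and
      \<open>muld \<eta> \<zeta> x\<close>. By commutativity this is symmetric in the three
      arguments, which gives invariance.\<close>
    show "double_form (double_mul s mul muld u v) w = double_form u (double_mul s mul muld v w)"
      if "u \<in> UNIV \<times> dual_space s" "v \<in> UNIV \<times> dual_space s" "w \<in> UNIV \<times> dual_space s" for u v w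
    proof (cases u; cases v; cases w)
      fix x \<xi> y \<eta> z \<zeta> assume [simp]: "u = (x, \<xi>)" "v = (y, \<eta>)" "w = (z, \<zeta>)"
      from that show ?thesis
        by (simp add: dual_simps coL_star_eq L_star_apply D.mul_commute[of \<eta> \<xi>] D.mul_commute[of \<zeta> \<xi>]
            D.mul_commute[of \<zeta> \<eta>] A.mul_commute[of y x] A.mul_commute[of z x] A.mul_commute[of z y])
    qed
    \<comment> \<open>Exchanging \<open>w\<close> and \<open>t\<close> interchanges, up to sign,
      terms such as \<open>\<theta> (br x y z)\<close> and \<open>- \<zeta> (br x y t')\<close>; the
      terms with both exchanged arguments inside one bracket change sign by skewness.\<close>
    show "double_form (double_br s br brd u v w) t = - double_form (double_br s br brd u v t) w"
      if "u \<in> UNIV \<times> dual_space s" "v \<in> UNIV \<times> dual_space s" "w \<in> UNIV \<times> dual_space s"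
        "t \<in> UNIV \<times> dual_space s" for u v w t
    proof (cases u; cases v; cases w; cases t)
      fix x \<xi> y \<eta> z \<zeta> t' \<theta> assume [simp]: "u = (x, \<xi>)" "v = (y, \<eta>)" "w = (z, \<zeta>)" "t = (t', \<theta>)"
      from that show ?thesis
        by (simp add: dual_simps coad_star_eq ad_star_apply D.br_skew23[of _ \<zeta> \<theta>]
            A.br_skew23[of _ z t'])
    qed
    show "poisson_three_lie_subalgebra (module_prod.scale s dual_scale) (UNIV \<times> dual_space s)
        (double_mul s mul muld) (double_br s br brd) (UNIV \<times> {0})"
      unfolding poisson_three_lie_subalgebra_def double_mul_eq double_br_eq
      by (auto simp: poisson_simps intro!: P.subspace_Times)
    show "poisson_three_lie_subalgebra (module_prod.scale s dual_scale) (UNIV \<times> dual_space s)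
        (double_mul s mul muld) (double_br s br brd) ({0} \<times> dual_space s)"
      unfolding poisson_three_lie_subalgebra_def double_mul_eq double_br_eq
      by (auto simp: poisson_simps intro!: P.subspace_Times D.subspace_carrier)
    show "double_form u v = 0" if "u \<in> UNIV \<times> {0}" "v \<in> UNIV \<times> {0}" for u v :: "'a \<times> ('a \<Rightarrow> 'f)"
      using that by auto
    show "double_form u v = 0" if "u \<in> {0} \<times> dual_space s" "v \<in> {0} \<times> dual_space s" for u v
      using that by (auto simp: dual_simps)
    show "(UNIV :: 'a set) \<times> dual_space s = {u + w |u w. u \<in> UNIV \<times> {0} \<and> w \<in> {0} \<times> dual_space s}"
      by (rule Times_eq_sum(1)) (simp_all add: D.carrier_simps)
    show "((UNIV :: 'a set) \<times> {0}) \<inter> ({0} \<times> dual_space s) = {0}"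
      by (auto simp: zero_prod_def D.carrier_simps)
    \<comment> \<open>The grading: such a bracket is a value of \<open>ad_star\<close> and lies in
      the dual.\<close>
    show "proj_along (UNIV \<times> {0}) ({0} \<times> dual_space s) (double_br s br brd u v w) = 0"
      if "u \<in> UNIV \<times> {0}" "v \<in> UNIV \<times> {0}" "w \<in> {0} \<times> dual_space s" for u v w
      using that unfolding double_br_eq by (auto simp: poisson_simps proj_along_dual)
    show "proj_along ({0} \<times> dual_space s) (UNIV \<times> {0}) (double_br s br brd u v w) = 0"
      if "u \<in> {0} \<times> dual_space s" "v \<in> {0} \<times> dual_space s" "w \<in> UNIV \<times> {0}" for u v w
      using that unfolding double_br_eq by (auto simp: poisson_simps proj_along_space)
  qed
qed

end

theorem theorem4p16:
  fixes s :: "'f::field_char_0 \<Rightarrow> 'a::ab_group_add \<Rightarrow> 'a"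
    and Basis :: "'a set"
    and mul :: "'a \<Rightarrow> 'a \<Rightarrow> 'a"
    and br :: "'a \<Rightarrow> 'a \<Rightarrow> 'a \<Rightarrow> 'a"
    and muld :: "('a \<Rightarrow> 'f) \<Rightarrow> ('a \<Rightarrow> 'f) \<Rightarrow> ('a \<Rightarrow> 'f)"
    and brd :: "('a \<Rightarrow> 'f) \<Rightarrow> ('a \<Rightarrow> 'f) \<Rightarrow> ('a \<Rightarrow> 'f) \<Rightarrow> ('a \<Rightarrow> 'f)"
  assumes "finite_dimensional_vector_space s Basis"
    and "poisson_three_lie_algebra s UNIV mul br"
    and "poisson_three_lie_algebra dual_scale (dual_space s) muld brd"
  shows "standard_manin_triple s mul br muld brd \<longleftrightarrow>
    matched_pair_poisson_three_lie s UNIV mul br dual_scale (dual_space s) muld brd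
      (ad_star br) (\<lambda>x \<xi>. - L_star mul x \<xi>)
      (coad_star s brd) (\<lambda>\<xi> x. - coL_star s muld \<xi> x)"
proof -
  interpret poisson_double s Basis mul br muld brd
    by (intro poisson_double.intro assms)
  show ?thesis
    using manin_axioms poisson_sum_iff
    unfolding standard_manin_triple_def manin_triple_def double_mul_eq double_br_eq by blast
qed

end
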